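(* Let $\mu$ be any probability measure on $\{0,1\}^{\mathbb N}$, let $n\in\mathbb N$ and $\delta\in(0,1)$. Let $X_1,\dots,X_n$ be i.i.d. draws from $\mu$ and let $\hat p_n=\frac1n\sum_{i=1}^nX_i\in[0,1]^{\mathbb N}$. Let $\tilde X_1,\dots,\tilde X_n$ be another i.i.d. sample from $\mu$, independent of $(X_1,\dots,X_n)$. Define $a\in\{0,1\}^{\mathbb N}$ and $\tilde p_n\in[0,1]^{\mathbb N}$ by $$a(j)=\mathbf 1\Big[\sum_{i=1}^n\tilde X_i(j)>\tfrac n2\Big],\qquad \tilde p_n(j)=(1-a(j))\,\hat p_n(j)+a(j)\,(1-\hat p_n(j)),\qquad j\in\mathbb N.$$ Then, with probability at least $1-\delta$ (over both samples), $$\Delta_n(\mu)\le\frac{16}{\sqrt n}\sqrt{S(\tilde p_n^{\downarrow})}+\sqrt{\frac{8\log(1/\delta)}{n}},$$ where $S(\tilde p_n^{\downarrow})$ is interpreted as $\infty$ when $\tilde p_n^{\downarrow}$ does not exist.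
   Context: $\mathbb N=\{1,2,3,\dots\}$; $\log$ is the natural logarithm. $\{0,1\}^{\mathbb N}$ carries the $\sigma$-algebra generated by finite-dimensional cylinders. For a probability measure $\mu$ on $\{0,1\}^{\mathbb N}$ with mean $p(j)=\mathbb E_{X\sim\mu}[X(j)]$, $\Delta_n(\mu)=\mathbb E\sup_{j\in\mathbb N}|\hat p_n(j)-p(j)|$, where $\hat p_n$ is the empirical mean of $n$ i.i.d. draws from $\mu$ (so $\Delta_n(\mu)$ is a deterministic number). For $u\in[0,1]^{\mathbb N}$ with $u(j)\to0$, $u^{\downarrow}$ denotes the non-increasing rearrangement of $u$ ($u^\downarrow(j)$ is the $j$-th largest entry, counted with multiplicity); if $u(j)\not\to0$, $u^{\downarrow}$ is regarded as not existing. For a non-increasing sequence $q$ in $[0,1]$, $S(q)=\sup_{j\in\mathbb N}q(j)\log(j+1)$. *)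

theory Defs
  imports "HOL-Probability.Probability"
begin

text \<open>
  The index set is \<open>{1..}\<close>, so an element of the space below is a function
  \<open>nat \<Rightarrow> real\<close> that takes values in \<open>{0, 1}\<close> on \<open>{1..}\<close> and is \<open>undefined\<close> at \<open>0\<close>.
  Its product \<sigma>-algebra is the one generated by the finite-dimensional cylinders.
  Only the \<sigma>-algebra of this measure is used.
\<close>

definition bit_seqs :: "(nat \<Rightarrow> real) measure" where
  "bit_seqs = PiM {1..} (\<lambda>_. count_space {0, 1})"

definition mean_seq :: "(nat \<Rightarrow> real) measure \<Rightarrow> nat \<Rightarrow> real" where
  "mean_seq \<mu> j = (\<integral>x. x j \<partial>\<mu>)"

definition emp_mean :: "nat \<Rightarrow> (nat \<Rightarrow> nat \<Rightarrow> real) \<Rightarrow> nat \<Rightarrow> real" where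
  "emp_mean n x j = (\<Sum>i=1..n. x i j) / real n"

definition Delta :: "nat \<Rightarrow> (nat \<Rightarrow> real) measure \<Rightarrow> real" where
  "Delta n \<mu> =
     (\<integral>x. (SUP j\<in>{1..}. \<bar>emp_mean n x j - mean_seq \<mu> j\<bar>) \<partial>(PiM {1..n} (\<lambda>_. \<mu>)))"

text \<open>
  The \<open>j\<close>-th largest entry, counted with multiplicity, is the greatest entry \<open>t\<close> such that
  at least \<open>j\<close> indices carry an entry \<open>\<ge> t\<close>; for \<open>j \<ge> 1\<close> it exists for nonnegative
  sequences tending to \<open>0\<close>.  Infinitely many indices may qualify, when \<open>t = 0\<close>.
\<close>

definition jth_largest :: "(nat \<Rightarrow> real) \<Rightarrow> nat \<Rightarrow> real" where
  "jth_largest u j =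
     (GREATEST t. t \<in> u ` {1..} \<and>
        (\<exists>F\<subseteq>{1..}. finite F \<and> card F = j \<and> (\<forall>i\<in>F. t \<le> u i)))"

definition decr_rearrangement :: "(nat \<Rightarrow> real) \<Rightarrow> (nat \<Rightarrow> real) option" where
  "decr_rearrangement u = (if u \<longlonglongrightarrow> 0 then Some (jth_largest u) else None)"

definition S :: "(nat \<Rightarrow> real) \<Rightarrow> ereal" where
  "S q = (SUP j\<in>{1..}. ereal (q j * ln (real j + 1)))"

definition S_opt :: "(nat \<Rightarrow> real) option \<Rightarrow> ereal" where
  "S_opt q = (case q of None \<Rightarrow> \<infinity> | Some q' \<Rightarrow> S q')"

text \<open>Intended for nonnegative arguments only.\<close>

definition ereal_sqrt :: "ereal \<Rightarrow> ereal" where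
  "ereal_sqrt x = (if x = \<infinity> then \<infinity> else ereal (sqrt (real_of_ereal x)))"

definition majority_bit :: "nat \<Rightarrow> (nat \<Rightarrow> nat \<Rightarrow> real) \<Rightarrow> nat \<Rightarrow> real" where
  "majority_bit n y j = (if (\<Sum>i=1..n. y i j) > real n / 2 then 1 else 0)"

definition flipped_mean ::
    "nat \<Rightarrow> (nat \<Rightarrow> nat \<Rightarrow> real) \<Rightarrow> (nat \<Rightarrow> nat \<Rightarrow> real) \<Rightarrow> nat \<Rightarrow> real" where
  "flipped_mean n x y j =
     (1 - majority_bit n y j) * emp_mean n x j + majority_bit n y j * (1 - emp_mean n x j)"

end

theory Submission
  imports Defs
begin

text \<open>
  Once the second sample is fixed, flipping the coordinates with \<open>a(j) = 1\<close> changes no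
  deviation \<open>\<bar>emp_mean n x j - mean_seq \<mu> j\<bar>\<close>, so it suffices to bound the expected uniform
  deviation of one fixed class of \<open>{0, 1}\<close>-valued functions by its empirical means.
  Symmetrization bounds the expected deviation by twice the expected Rademacher average, and the
  Rademacher average is a function of the sample with bounded differences, so it is not much
  smaller than its expectation except with probability \<open>\<delta>\<close>.  For a given sample, the \<open>k\<close>-th
  largest coordinate contributes a subgaussian variable of variance proxy \<open>n q(k) \<le> n S / log (k + 1)\<close>,
  and the expected maximum of such variables is \<open>O(sqrt (n S))\<close>.  How \<open>a\<close> is computed
  from the second sample plays no role beyond measurability.
\<close>

section \<open>Rademacher averages of a finite matrix\<close>

text \<open>The bound is stated through \<open>S\<close> of the observed means, which one sample
  point can make infinite. Concentration is therefore applied to the Rademacher average, where one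
  point moves the value by at most 1, and \<open>S\<close> enters only afterwards, for a fixed
  sample. Fixing the sample also fixes the order of the coordinates, so ranks may depend on the data
  without a union over orderings. Means are multiples of 1/n, so a finite \<open>S\<close> leaves
  finitely many nonzero columns and the infinite index set shrinks to a finite list. The expected
  maximum over that list must not depend on its length: each column gets its own exponential
  parameter, and the column of rank k exceeds one common threshold by O(1/(k+1)^2) of it in
  expectation. All quantities are sums over the sample; division by n comes last. Threshold and
  total excess give 4 sqrt (n S), which symmetrization doubles to 8, within the claimed 16. The
  fluctuation sqrt (2 n log (1/\<delta>)) is doubled likewise and becomes sqrt (8 log (1/\<delta>) /
  n).\<close>

lemma exp_add_exp_minus_le: "exp x + exp (- x) \<le> 2 * exp (x\<^sup>2 / 2)" for x :: real
proof -
  have pos: "exp l + exp (- l) \<le> 2 * exp (l\<^sup>2 / 2)" if "l > 0" for l :: real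
  proof -
    \<comment> \<open>A uniform sign has mean 0 and lives in an interval of width 2, so Hoeffding's
      lemma bounds its moment generating function cosh l by exp (l^2 / 2). Hoeffding's lemma wants l
      > 0; evenness of cosh covers the rest.\<close>
    let ?p = "pmf_of_set {-1, 1 :: real}"
    interpret interval_bounded_random_variable "measure_pmf ?p" "\<lambda>x. x" "-1" 1
      by unfold_locales (auto simp: AE_measure_pmf_iff)
    have E: "measure_pmf.expectation ?p h = (h (-1) + h 1) / 2" for h :: "real \<Rightarrow> real"
      by (subst integral_pmf_of_set) auto
    have "(\<integral>\<^sup>+x. ennreal (exp (l * x)) \<partial>?p) = ennreal (measure_pmf.expectation ?p (\<lambda>x. exp (l * x)))"
      by (intro nn_integral_eq_integral integrable_measure_pmf_finite) auto
    then have "ennreal ((exp (- l) + exp l) / 2) \<le> ennreal (exp (l\<^sup>2 * (1 - (-1))\<^sup>2 / 8))"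
      using Hoeffdings_lemma_nn_integral_0[OF that] by (simp add: E)
    then show ?thesis
      by (simp add: add.commute)
  qed
  consider "x > 0" | "x = 0" | "- x > 0" by linarith
  then show ?thesis
    by cases (use pos[of x] pos[of "- x"] in \<open>auto simp: add.commute\<close>)
qed

text \<open>The expectation over independent uniform signs, written as a finite average: exchanging
  it with an integral over the sample is then mere linearity.\<close>

definition rademacher_avg :: "'i set \<Rightarrow> 'j set \<Rightarrow> ('i \<Rightarrow> 'j \<Rightarrow> real) \<Rightarrow> real" where
  "rademacher_avg I J w =
     (\<Sum>e\<in>I \<rightarrow>\<^sub>E {- 1, 1}. SUP j\<in>J. \<bar>\<Sum>i\<in>I. e i * w i j\<bar>) / 2 ^ card I"

lemma card_signs: "finite I \<Longrightarrow> card (I \<rightarrow>\<^sub>E {- 1, 1 :: real}) = 2 ^ card I"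
  by (subst card_PiE) (auto simp: numeral_2_eq_2)

text \<open>Independence of the signs appears as distributivity: the sum over sign vectors of a
  product is a product of two-term sums, each a cosh. The leading 2 pays for the absolute value, by
  adding the bounds for l and -l.\<close>

lemma sum_signs_exp_le:
  fixes l :: real
  assumes "finite I"
  shows "(\<Sum>e\<in>I \<rightarrow>\<^sub>E {- 1, 1}. exp (l * \<bar>\<Sum>i\<in>I. e i * v i\<bar>))
           \<le> 2 * 2 ^ card I * exp (l\<^sup>2 / 2 * (\<Sum>i\<in>I. (v i)\<^sup>2))"
proof -
  have mgf: "(\<Sum>e\<in>I \<rightarrow>\<^sub>E {- 1, 1}. exp (c * (\<Sum>i\<in>I. e i * v i)))
      \<le> 2 ^ card I * exp (c\<^sup>2 / 2 * (\<Sum>i\<in>I. (v i)\<^sup>2))" for c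
  proof -
    have "(\<Sum>e\<in>I \<rightarrow>\<^sub>E {- 1, 1}. exp (c * (\<Sum>i\<in>I. e i * v i)))
        = (\<Sum>e\<in>I \<rightarrow>\<^sub>E {- 1, 1}. \<Prod>i\<in>I. exp (c * (e i * v i)))"
      using assms by (simp add: sum_distrib_left exp_sum)
    also have "\<dots> = (\<Prod>i\<in>I. \<Sum>y\<in>{- 1, 1}. exp (c * (y * v i)))"
      using assms by (subst prod_sum_PiE) auto
    also have "\<dots> = (\<Prod>i\<in>I. exp (c * v i) + exp (- (c * v i)))"
      by (intro prod.cong) auto
    also have "\<dots> \<le> (\<Prod>i\<in>I. 2 * exp ((c * v i)\<^sup>2 / 2))"
      by (intro prod_mono) (auto intro: exp_add_exp_minus_le)
    also have "\<dots> = 2 ^ card I * exp (\<Sum>i\<in>I. (c * v i)\<^sup>2 / 2)"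
      using assms by (simp add: prod.distrib exp_sum)
    also have "(\<Sum>i\<in>I. (c * v i)\<^sup>2 / 2) = c\<^sup>2 / 2 * (\<Sum>i\<in>I. (v i)\<^sup>2)"
      by (simp add: sum_distrib_left power_mult_distrib)
    finally show ?thesis .
  qed
  have "exp (l * \<bar>t\<bar>) \<le> exp (l * t) + exp (- l * t)" for t
    by (cases "t \<ge> 0") auto
  then have "(\<Sum>e\<in>I \<rightarrow>\<^sub>E {- 1, 1}. exp (l * \<bar>\<Sum>i\<in>I. e i * v i\<bar>))
     \<le> (\<Sum>e\<in>I \<rightarrow>\<^sub>E {- 1, 1}. exp (l * (\<Sum>i\<in>I. e i * v i)) + exp (- l * (\<Sum>i\<in>I. e i * v i)))"
    by (intro sum_mono)
  also have "\<dots> \<le> 2 * 2 ^ card I * exp (l\<^sup>2 / 2 * (\<Sum>i\<in>I. (v i)\<^sup>2))"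
    using mgf[of l] mgf[of "- l"] unfolding sum.distrib by simp
  finally show ?thesis .
qed

text \<open>Telescoping, since 1/(k+2)^2 is at most 1/(k+1) - 1/(k+2). This keeps the maximal
  inequality free of the number of columns.\<close>

lemma sum_inverse_squares_le_1: "(\<Sum>k<m. 1 / (real k + 2)\<^sup>2) \<le> 1"
proof -
  have "(\<Sum>k<m. 1 / (real k + 2)\<^sup>2) \<le> 1 - 1 / (real m + 1)"
  proof (induction m)
    case (Suc m)
    have "1 / (real m + 2)\<^sup>2 \<le> 1 / ((real m + 1) * (real m + 2))"
      by (intro divide_left_mono) (auto simp: power2_eq_square)
    also have "\<dots> = 1 / (real m + 1) - 1 / (real m + 2)"
      by (simp add: divide_simps)
    finally have "1 / (real m + 2)\<^sup>2 \<le> 1 / (real m + 1) - 1 / (real m + 2)" .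
    with Suc show ?case by (simp add: add.commute)
  qed simp
  also have "\<dots> \<le> 1" by simp
  finally show ?thesis .
qed

text \<open>Entries in [0,1] make the squared norm of a column at most its sum, so column k of
  \<open>xs\<close> has variance proxy at most V / ln (k + 2): the logarithm in the hypothesis is
  what a maximum over the first k columns costs. With s = sqrt V, the threshold 2 s and the expected
  excesses over it, at most 2 s / (k + 2)^2 each, add up to 4 s. Positions count from 0, whence the
  shift by 2.\<close>

lemma rademacher_avg_le:
  assumes I: "finite I" and J: "J \<noteq> {}"
    and w: "\<And>i j. i \<in> I \<Longrightarrow> j \<in> J \<Longrightarrow> w i j \<in> {0..1}"
    and xs: "set xs \<subseteq> J" "\<And>i j. i \<in> I \<Longrightarrow> j \<in> J - set xs \<Longrightarrow> w i j = 0"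
    and V: "V \<ge> 0" "\<And>k. k < length xs \<Longrightarrow> (\<Sum>i\<in>I. w i (xs ! k)) * ln (real k + 2) \<le> V"
  shows "rademacher_avg I J w \<le> 4 * sqrt V"
proof (cases "V = 0")
  \<comment> \<open>The exponential parameters below divide by sqrt V, so this case stands apart:
    every column sum vanishes, and with it every entry.\<close>
  case True
  have "w i j = 0" if "i \<in> I" "j \<in> J" for i j
  proof (cases "j \<in> set xs")
    case True
    then obtain k where k: "k < length xs" "xs ! k = j"
      by (auto simp: in_set_conv_nth)
    have "(\<Sum>i\<in>I. w i j) \<le> 0"
      using V(2)[OF k(1)] \<open>V = 0\<close> k(2) by (simp add: mult_le_0_iff)
    moreover have "(\<Sum>i\<in>I. w i j) \<ge> w i j"
      using w I that by (intro member_le_sum) auto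
    ultimately show ?thesis using w[OF that] by auto
  qed (use xs that in auto)
  then have "(SUP j\<in>J. \<bar>\<Sum>i\<in>I. e i * w i j\<bar>) = (SUP j\<in>J. 0)" for e
    by (intro SUP_cong) auto
  then show ?thesis
    using J True by (simp add: rademacher_avg_def)
next
  case False
  define s where "s = sqrt V"
  have s: "s > 0" "s\<^sup>2 = V"
    using V(1) False by (auto simp: s_def)
  define L where "L k = ln (real k + 2)" for k :: nat
  have L: "L k \<ge> 1/2" for k
  proof -
    have "1/2 \<le> ln (2 :: real)" using ln2_ge_two_thirds by linarith
    also have "\<dots> \<le> L k" by (simp add: L_def)
    finally show ?thesis .
  qed
  have L0: "L k > 0" for k using L[of k] by linarith
  define Z where "Z e j = \<bar>\<Sum>i\<in>I. e i * w i j\<bar>" for e j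
  \<comment> \<open>The minimiser of the exponent l^2 s^2 / (2 L k) - 2 l s, whose minimum is - 2 L
    k; hence the factor 1/(k+2)^2. As \<open>L k \<ge> 1/2\<close>, also 1 / l k \<le> s.\<close>
  define l where "l k = 2 * L k / s" for k
  have l: "l k > 0" for k using L0 s by (simp add: l_def)
  \<comment> \<open>A nonnegative majorant of the excess of column k over 2 s, from u \<le> exp (l
    u) / l. Its average over the signs is computable.\<close>
  define T where "T e k = exp (l k * (Z e (xs ! k) - 2 * s)) / l k" for e k
  have T0: "T e k \<ge> 0" for e k using l[of k] by (simp add: T_def)
  \<comment> \<open>The maximum is bounded by a threshold plus the exponential excesses over it.\<close>
  have SUP: "(SUP j\<in>J. Z e j) \<le> 2 * s + (\<Sum>k<length xs. T e k)" for e
  proof (intro cSUP_least J)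
    fix j assume j: "j \<in> J"
    show "Z e j \<le> 2 * s + (\<Sum>k<length xs. T e k)"
    proof (cases "j \<in> set xs")
      case True
      then obtain k where k: "k < length xs" "xs ! k = j"
        by (auto simp: in_set_conv_nth)
      have "l k * (Z e j - 2 * s) \<le> exp (l k * (Z e j - 2 * s))"
        using exp_ge_add_one_self[of "l k * (Z e j - 2 * s)"] by linarith
      then have "Z e j - 2 * s \<le> T e k"
        using l[of k] k by (simp add: T_def pos_le_divide_eq mult.commute)
      also have "\<dots> \<le> (\<Sum>k<length xs. T e k)"
        using k T0 by (intro member_le_sum) auto
      finally show ?thesis by simp
    next
      case False
      then have "Z e j = 0" using xs j by (simp add: Z_def)
      then show ?thesis using s T0 by (simp add: sum_nonneg)
    qed
  qed
  have T: "(\<Sum>e\<in>I \<rightarrow>\<^sub>E {- 1, 1}. T e k) \<le> 2 ^ card I * (2 * s * (1 / (real k + 2)\<^sup>2))"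
    if k: "k < length xs" for k
  proof -
    have "xs ! k \<in> J" using xs k by auto
    then have "(\<Sum>i\<in>I. (w i (xs ! k))\<^sup>2) \<le> (\<Sum>i\<in>I. w i (xs ! k))"
      using w by (intro sum_mono) (auto simp: power2_eq_square mult_left_le)
    also have "\<dots> \<le> s\<^sup>2 / L k"
      using V(2)[OF k] L0[of k] s by (simp add: L_def field_simps)
    finally have "(l k)\<^sup>2 / 2 * (\<Sum>i\<in>I. (w i (xs ! k))\<^sup>2) \<le> (l k)\<^sup>2 / 2 * (s\<^sup>2 / L k)"
      by (intro mult_left_mono) auto
    also have "\<dots> = 2 * L k"
      using s(1) L0[of k] by (simp add: l_def field_simps power2_eq_square)
    finally have e: "(l k)\<^sup>2 / 2 * (\<Sum>i\<in>I. (w i (xs ! k))\<^sup>2) \<le> 2 * L k" .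
    have T_eq: "T e k = exp (l k * Z e (xs ! k)) * (exp (- (l k * (2 * s))) / l k)" for e
      by (simp add: T_def right_diff_distrib mult_exp_exp)
    have "(\<Sum>e\<in>I \<rightarrow>\<^sub>E {- 1, 1}. T e k)
        = (\<Sum>e\<in>I \<rightarrow>\<^sub>E {- 1, 1}. exp (l k * Z e (xs ! k))) * (exp (- (l k * (2 * s))) / l k)"
      by (simp only: T_eq sum_distrib_right)
    also have "\<dots> \<le> (2 * 2 ^ card I * exp (2 * L k)) * (exp (- (l k * (2 * s))) / l k)"
      using sum_signs_exp_le[OF I, of "l k" "\<lambda>i. w i (xs ! k)"] e l[of k]
      unfolding Z_def by (intro mult_right_mono) (auto elim!: order_trans)
    also have "l k * (2 * s) = 4 * L k" using s by (simp add: l_def)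
    also have "(2 * 2 ^ card I * exp (2 * L k)) * (exp (- (4 * L k)) / l k)
        = 2 ^ card I * (2 * exp (- (2 * L k)) / l k)"
      by (simp add: mult_exp_exp field_simps)
    also have "exp (- (2 * L k)) = 1 / (real k + 2)\<^sup>2"
    proof -
      have "exp (- (2 * L k)) = inverse (exp (L k)) ^ 2"
        by (simp add: exp_minus exp_double power_inverse)
      then show ?thesis by (simp add: L_def power_one_over inverse_eq_divide)
    qed
    also have "2 * (1 / (real k + 2)\<^sup>2) / l k \<le> 2 * s * (1 / (real k + 2)\<^sup>2)"
    proof -
      have "1 / l k \<le> s" using L[of k] L0[of k] s by (simp add: l_def field_simps)
      then have "2 * (1 / (real k + 2)\<^sup>2) * (1 / l k) \<le> 2 * (1 / (real k + 2)\<^sup>2) * s"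
        by (intro mult_left_mono) auto
      then show ?thesis by (simp add: ac_simps)
    qed
    finally show ?thesis by simp
  qed
  have "(\<Sum>e\<in>I \<rightarrow>\<^sub>E {- 1, 1}. SUP j\<in>J. Z e j)
      \<le> (\<Sum>e\<in>I \<rightarrow>\<^sub>E {- 1, 1}. 2 * s + (\<Sum>k<length xs. T e k))"
    by (intro sum_mono SUP)
  also have "\<dots> = 2 ^ card I * (2 * s) + (\<Sum>k<length xs. \<Sum>e\<in>I \<rightarrow>\<^sub>E {- 1, 1}. T e k)"
    using I by (simp add: sum.distrib card_signs sum.swap[of _ "I \<rightarrow>\<^sub>E {- 1, 1}"])
  also have "\<dots> \<le> 2 ^ card I * (2 * s) + (\<Sum>k<length xs. 2 ^ card I * (2 * s * (1 / (real k + 2)\<^sup>2)))"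
    by (intro add_left_mono sum_mono T) auto
  also have "\<dots> = 2 ^ card I * (2 * s) + 2 ^ card I * (2 * s) * (\<Sum>k<length xs. 1 / (real k + 2)\<^sup>2)"
    by (simp add: sum_distrib_left mult.assoc)
  also have "\<dots> \<le> 2 ^ card I * (2 * s) + 2 ^ card I * (2 * s) * 1"
    using s by (intro add_left_mono mult_left_mono sum_inverse_squares_le_1) auto
  finally show ?thesis
    by (simp add: rademacher_avg_def Z_def s_def field_simps)
qed


section \<open>Bounded differences\<close>

text \<open>Induction on the coordinates, for all f at once. Integrating out one coordinate leaves a
  function g of the others with the same bound and the same differences; the error f - g is centred
  in that coordinate and costs one factor from Hoeffding's lemma.\<close>

lemma bounded_differences_mgf:
  fixes f :: "('i \<Rightarrow> 'a) \<Rightarrow> real"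
  assumes N: "prob_space N" and I: "finite I" and l: "l > 0"
    and f: "f \<in> borel_measurable (PiM I (\<lambda>_. N))"
    and bnd: "\<And>x. x \<in> space (PiM I (\<lambda>_. N)) \<Longrightarrow> \<bar>f x\<bar> \<le> B"
    and diff: "\<And>x i y. x \<in> space (PiM I (\<lambda>_. N)) \<Longrightarrow> i \<in> I \<Longrightarrow> y \<in> space N \<Longrightarrow>
                 \<bar>f (x(i := y)) - f x\<bar> \<le> c"
  shows "(\<integral>x. exp (l * ((\<integral>x. f x \<partial>PiM I (\<lambda>_. N)) - f x)) \<partial>PiM I (\<lambda>_. N))
           \<le> exp (real (card I) * (l\<^sup>2 * c\<^sup>2 / 2))"
  using I f bnd diff
proof (induction I arbitrary: f rule: finite_induct)
  case empty
  interpret prob_space "PiM {} (\<lambda>_ :: 'i. N)"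
    by (intro prob_space_PiM N)
  have [simp]: "f (\<lambda>k. undefined) = (\<integral>x. f x \<partial>PiM {} (\<lambda>_. N))"
  proof -
    have "(\<integral>x. f x \<partial>PiM {} (\<lambda>_. N)) = (\<integral>x. f (\<lambda>k. undefined) \<partial>PiM {} (\<lambda>_ :: 'i. N))"
      by (intro Bochner_Integration.integral_cong) (auto simp: space_PiM)
    then show ?thesis by (simp add: prob_space)
  qed
  have "(\<integral>x. exp (l * ((\<integral>x. f x \<partial>PiM {} (\<lambda>_. N)) - f x)) \<partial>PiM {} (\<lambda>_. N))
     = (\<integral>x. 1 \<partial>PiM {} (\<lambda>_ :: 'i. N))"
    by (intro Bochner_Integration.integral_cong) (auto simp: space_PiM)
  then show ?case by (simp add: prob_space)
next
  case (insert i I)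
  let ?P = "PiM I (\<lambda>_. N)" and ?Q = "PiM (insert i I) (\<lambda>_. N)"
  interpret N: prob_space N by fact
  interpret P: prob_space ?P by (intro prob_space_PiM N)
  interpret Q: prob_space ?Q by (intro prob_space_PiM N)
  interpret product_sigma_finite "\<lambda>_ :: 'i. N" ..
  note [measurable] = insert.prems(1)
  have upd: "x(i := y) \<in> space ?Q" if "x \<in> space ?P" "y \<in> space N" for x y
    using that by (auto simp: space_PiM PiE_def extensional_def)
  have upd_m[measurable]: "(\<lambda>(x, y). x(i := y)) \<in> measurable (?P \<Otimes>\<^sub>M N) ?Q"
    by (rule measurable_add_dim)
  \<comment> \<open>The conditional expectation of f given the coordinates in \<open>I\<close>; the
    induction hypothesis is applied to it.\<close>
  define g where "g x = (\<integral>y. f (x(i := y)) \<partial>N)" for x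
  have fm[measurable]: "(\<lambda>y. f (x(i := y))) \<in> borel_measurable N" if "x \<in> space ?P" for x
    using that by measurable
  have fi: "integrable N (\<lambda>y. f (x(i := y)))" if "x \<in> space ?P" for x
    using that upd insert.prems(2) by (intro N.integrable_const_bound[of _ B]) auto
  have gm[measurable]: "g \<in> borel_measurable ?P"
    unfolding g_def by measurable
  have gb: "\<bar>g x\<bar> \<le> B" if "x \<in> space ?P" for x
  proof -
    have "\<bar>g x\<bar> \<le> (\<integral>y. \<bar>f (x(i := y))\<bar> \<partial>N)"
      unfolding g_def by (rule integral_abs_bound)
    also have "\<dots> \<le> (\<integral>y. B \<partial>N)"
      using that upd insert.prems(2) fi by (intro integral_mono) auto
    finally show ?thesis by (simp add: N.prob_space)
  qed
  have gd: "\<bar>g (x(k := z)) - g x\<bar> \<le> c" if "x \<in> space ?P" "k \<in> I" "z \<in> space N" for x k z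
  proof -
    have x': "x(k := z) \<in> space ?P"
      using that by (auto simp: space_PiM PiE_def extensional_def)
    have "\<bar>g (x(k := z)) - g x\<bar> = \<bar>\<integral>y. f (x(k := z, i := y)) - f (x(i := y)) \<partial>N\<bar>"
      using that fi x' by (simp add: g_def)
    also have "\<dots> \<le> (\<integral>y. \<bar>f (x(k := z, i := y)) - f (x(i := y))\<bar> \<partial>N)"
      by (rule integral_abs_bound)
    also have "\<dots> \<le> (\<integral>y. c \<partial>N)"
    proof (intro integral_mono)
      fix y assume y: "y \<in> space N"
      have "k \<noteq> i" using that insert.hyps by auto
      then have "x(k := z, i := y) = (x(i := y))(k := z)" by (simp add: fun_upd_twist)
      then show "\<bar>f (x(k := z, i := y)) - f (x(i := y))\<bar> \<le> c"
        using insert.prems(3)[OF upd[OF that(1) y], of k z] that by (simp only: insert_iff simp_thms)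
    qed (use fi[OF x'] fi[OF that(1)] in auto)
    finally show ?thesis by (simp add: N.prob_space)
  qed
  have E: "(\<integral>x. f x \<partial>?Q) = (\<integral>x. g x \<partial>?P)"
    unfolding g_def using insert.prems(2) insert.hyps
    by (intro product_integral_insert Q.integrable_const_bound[of _ B]) auto
  let ?m = "\<integral>x. g x \<partial>?P"
  have mb: "\<bar>?m\<bar> \<le> B"
  proof -
    have "\<bar>?m\<bar> \<le> (\<integral>x. \<bar>g x\<bar> \<partial>?P)" by (rule integral_abs_bound)
    also have "\<dots> \<le> (\<integral>x. B \<partial>?P)"
      using gb by (intro integral_mono integrable_abs P.integrable_const P.integrable_const_bound[of _ B]) auto
    finally show ?thesis by (simp add: P.prob_space)
  qed
  have one: "(\<integral>y. exp (l * (g x - f (x(i := y)))) \<partial>N) \<le> exp (l\<^sup>2 * c\<^sup>2 / 2)" if x: "x \<in> space ?P" for x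
  proof -
    have d: "\<bar>g x - f (x(i := y))\<bar> \<le> c" if y: "y \<in> space N" for y
    proof -
      have "g x - f (x(i := y)) = (\<integral>y'. f (x(i := y')) - f (x(i := y)) \<partial>N)"
        using fi[OF x] by (simp add: g_def N.prob_space)
      also have "\<bar>\<dots>\<bar> \<le> (\<integral>y'. \<bar>f (x(i := y')) - f (x(i := y))\<bar> \<partial>N)"
        by (rule integral_abs_bound)
      also have "\<dots> \<le> (\<integral>y'. c \<partial>N)"
      proof (intro integral_mono)
        fix y' assume "y' \<in> space N"
        then show "\<bar>f (x(i := y')) - f (x(i := y))\<bar> \<le> c"
          using insert.prems(3)[OF upd[OF x y], of i y'] by (simp only: insert_iff simp_thms fun_upd_upd)
      qed (use fi[OF x] in auto)
      finally show ?thesis by (simp add: N.prob_space)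
    qed
    \<comment> \<open>The symmetric interval has width 2 c, and (2 c)^2 / 8 = c^2 / 2 is the
      constant per coordinate.\<close>
    interpret interval_bounded_random_variable N "\<lambda>y. g x - f (x(i := y))" "- c" c
      using x d by unfold_locales (auto simp: abs_le_iff intro!: AE_I2, force+)
    have "N.expectation (\<lambda>y. g x - f (x(i := y))) = 0"
      using fi[OF x] by (simp add: g_def N.prob_space)
    moreover have "l\<^sup>2 * (c - - c)\<^sup>2 / 8 = l\<^sup>2 * c\<^sup>2 / 2"
      by (simp add: power2_eq_square)
    ultimately have "(\<integral>\<^sup>+y. exp (l * (g x - f (x(i := y)))) \<partial>N) \<le> ennreal (exp (l\<^sup>2 * c\<^sup>2 / 2))"
      using Hoeffdings_lemma_nn_integral_0[OF l] by metis
    then show ?thesis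
      using x by (subst integral_eq_nn_integral) (auto intro!: enn2real_leI)
  qed
  \<comment> \<open>Mean and function are both bounded by B, so exponents stay below 2 l B; this
    supplies integrability.\<close>
  have ei: "exp (l * (?m - f x)) \<le> exp (l * (2 * B))" if "x \<in> space ?Q" for x
    using insert.prems(2)[OF that] mb l by (auto simp: abs_le_iff)
  have gi: "exp (l * (?m - g x)) \<le> exp (l * (2 * B))" if "x \<in> space ?P" for x
    using gb[OF that] mb l by (auto simp: abs_le_iff)
  have "(\<integral>x. exp (l * (?m - f x)) \<partial>?Q) = (\<integral>x. \<integral>y. exp (l * (?m - f (x(i := y)))) \<partial>N \<partial>?P)"
    using insert.hyps ei by (intro product_integral_insert Q.integrable_const_bound[of _ "exp (l * (2 * B))"]) auto
  \<comment> \<open>Split m - f as (m - g) + (g - f): the first part does not see the new coordinate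
    and leaves the inner integral.\<close>
  also have "\<dots> = (\<integral>x. exp (l * (?m - g x)) * (\<integral>y. exp (l * (g x - f (x(i := y)))) \<partial>N) \<partial>?P)"
    by (subst integral_mult_right_zero[symmetric])
       (simp add: mult_exp_exp algebra_simps)
  also have "\<dots> \<le> (\<integral>x. exp (l * (?m - g x)) * exp (l\<^sup>2 * c\<^sup>2 / 2) \<partial>?P)"
  proof (intro integral_mono')
    show "integrable ?P (\<lambda>x. exp (l * (?m - g x)) * exp (l\<^sup>2 * c\<^sup>2 / 2))"
      using gi by (intro integrable_mult_left P.integrable_const_bound[of _ "exp (l * (2 * B))"]) auto
  qed (use one in auto)
  also have "\<dots> = (\<integral>x. exp (l * (?m - g x)) \<partial>?P) * exp (l\<^sup>2 * c\<^sup>2 / 2)"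
    by simp
  also have "\<dots> \<le> exp (real (card I) * (l\<^sup>2 * c\<^sup>2 / 2)) * exp (l\<^sup>2 * c\<^sup>2 / 2)"
    by (intro mult_right_mono insert.IH gm gb gd) auto
  also have "\<dots> = exp (real (card (insert i I)) * (l\<^sup>2 * c\<^sup>2 / 2))"
    using insert.hyps by (simp add: mult_exp_exp algebra_simps)
  finally show ?case by (simp add: E)
qed

lemma bounded_differences_lower_tail:
  fixes f :: "('i \<Rightarrow> 'a) \<Rightarrow> real"
  assumes N: "prob_space N" and I: "finite I"
    and f: "f \<in> borel_measurable (PiM I (\<lambda>_. N))"
    and bnd: "\<And>x. x \<in> space (PiM I (\<lambda>_. N)) \<Longrightarrow> \<bar>f x\<bar> \<le> B"
    and diff: "\<And>x i y. x \<in> space (PiM I (\<lambda>_. N)) \<Longrightarrow> i \<in> I \<Longrightarrow> y \<in> space N \<Longrightarrow>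
                 \<bar>f (x(i := y)) - f x\<bar> \<le> c"
    and t: "t > 0" "c > 0" "card I > 0"
  shows "measure (PiM I (\<lambda>_. N)) {x \<in> space (PiM I (\<lambda>_. N)). (\<integral>x. f x \<partial>PiM I (\<lambda>_. N)) - f x \<ge> t}
           \<le> exp (- t\<^sup>2 / (2 * real (card I) * c\<^sup>2))"
proof -
  let ?P = "PiM I (\<lambda>_. N)"
  interpret P: prob_space ?P by (intro prob_space_PiM N)
  note [measurable] = f
  let ?m = "\<integral>x. f x \<partial>?P"
  \<comment> \<open>The Chernoff parameter: it minimises |I| l^2 c^2 / 2 - l t.\<close>
  define l where "l = t / (real (card I) * c\<^sup>2)"
  have l: "l > 0" using t by (simp add: l_def)
  have "integrable ?P (\<lambda>x. exp (l * (?m - f x)))"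
  proof (rule P.integrable_const_bound[of _ "exp (l * (\<bar>?m\<bar> + B))"])
    show "AE x in ?P. norm (exp (l * (?m - f x))) \<le> exp (l * (\<bar>?m\<bar> + B))"
      using l bnd by (intro AE_I2) (force simp: abs_le_iff)
  qed auto
  then have "measure ?P {x \<in> space ?P. exp (l * (?m - f x)) \<ge> exp (l * t)}
      \<le> (\<integral>x. exp (l * (?m - f x)) \<partial>?P) / exp (l * t)"
    by (intro integral_Markov_inequality_measure[of _ _ "{}"]) auto
  also have "\<dots> \<le> exp (real (card I) * (l\<^sup>2 * c\<^sup>2 / 2)) / exp (l * t)"
    by (intro divide_right_mono bounded_differences_mgf[OF N I l f bnd diff]) auto
  also have "\<dots> = exp (real (card I) * (l\<^sup>2 * c\<^sup>2 / 2) - l * t)"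
    by (simp add: exp_diff)
  also have "real (card I) * (l\<^sup>2 * c\<^sup>2 / 2) - l * t = - t\<^sup>2 / (2 * real (card I) * c\<^sup>2)"
    using t by (simp add: l_def field_simps power2_eq_square)
  finally show ?thesis using l by simp
qed


section \<open>Symmetrization\<close>

lemma SUP_abs_bounded:
  fixes h :: "'j \<Rightarrow> real"
  assumes "J \<noteq> {}" and "\<And>j. j \<in> J \<Longrightarrow> \<bar>h j\<bar> \<le> B"
  shows "bdd_above ((\<lambda>j. \<bar>h j\<bar>) ` J)" "(SUP j\<in>J. \<bar>h j\<bar>) \<in> {0..B}"
proof -
  show bdd: "bdd_above ((\<lambda>j. \<bar>h j\<bar>) ` J)"
    using assms(2) by (auto intro!: bdd_aboveI)
  obtain j where "j \<in> J" using assms(1) by auto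
  then have "0 \<le> (SUP j\<in>J. \<bar>h j\<bar>)"
    by (intro cSUP_upper2[OF bdd]) auto
  then show "(SUP j\<in>J. \<bar>h j\<bar>) \<in> {0..B}"
    using assms by (auto intro: cSUP_least)
qed

text \<open>The supremum norm is 1-Lipschitz. Suprema are taken in \<open>real\<close>, so the
  bounds A and B are there to make them meaningful. It carries a one-point change of the sample
  through the supremum over coordinates.\<close>

lemma SUP_abs_diff_le:
  fixes a b :: "'j \<Rightarrow> real"
  assumes J: "J \<noteq> {}" and a: "\<And>j. j \<in> J \<Longrightarrow> \<bar>a j\<bar> \<le> A" and b: "\<And>j. j \<in> J \<Longrightarrow> \<bar>b j\<bar> \<le> B"
    and d: "\<And>j. j \<in> J \<Longrightarrow> \<bar>a j - b j\<bar> \<le> c"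
  shows "\<bar>(SUP j\<in>J. \<bar>a j\<bar>) - (SUP j\<in>J. \<bar>b j\<bar>)\<bar> \<le> c"
proof -
  have le: "(SUP j\<in>J. \<bar>u j\<bar>) \<le> (SUP j\<in>J. \<bar>v j\<bar>) + c"
    if v: "\<And>j. j \<in> J \<Longrightarrow> \<bar>v j\<bar> \<le> C" and uv: "\<And>j. j \<in> J \<Longrightarrow> \<bar>u j - v j\<bar> \<le> c" for u v :: "'j \<Rightarrow> real" and C
  proof (intro cSUP_least J)
    fix j assume j: "j \<in> J"
    have "\<bar>v j\<bar> \<le> (SUP j\<in>J. \<bar>v j\<bar>)"
      using j SUP_abs_bounded(1)[OF J v] by (intro cSUP_upper) auto
    then show "\<bar>u j\<bar> \<le> (SUP j\<in>J. \<bar>v j\<bar>) + c"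
      using uv[OF j] by linarith
  qed
  show ?thesis
    using le[of b B a, OF b d] le[of a A b, OF a] d by (force simp: abs_le_iff abs_minus_commute)
qed

text \<open>Countability of the index set makes the supremum measurable, and the uniform bound makes
  it integrable.\<close>

lemma (in finite_measure) integrable_SUP_abs:
  fixes h :: "'j \<Rightarrow> 'a \<Rightarrow> real"
  assumes J: "countable J" "J \<noteq> {}"
    and h: "\<And>j. j \<in> J \<Longrightarrow> h j \<in> borel_measurable M"
    and b: "\<And>j x. j \<in> J \<Longrightarrow> x \<in> space M \<Longrightarrow> \<bar>h j x\<bar> \<le> B"
  shows "(\<lambda>x. SUP j\<in>J. \<bar>h j x\<bar>) \<in> borel_measurable M" "integrable M (\<lambda>x. SUP j\<in>J. \<bar>h j x\<bar>)"
proof -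
  show m: "(\<lambda>x. SUP j\<in>J. \<bar>h j x\<bar>) \<in> borel_measurable M"
    using J b h by (intro borel_measurable_cSUP borel_measurable_abs SUP_abs_bounded) auto
  show "integrable M (\<lambda>x. SUP j\<in>J. \<bar>h j x\<bar>)"
    using SUP_abs_bounded(2)[of J "\<lambda>j. h j x" B for x, OF J(2) b] m
    by (intro integrable_const_bound[of _ B]) auto
qed

section \<open>Countable classes of functions with values in [0,1]\<close>

locale bounded_class = prob_space N for N :: "'a measure" +
  fixes J :: "'j set" and g :: "'j \<Rightarrow> 'a \<Rightarrow> real"
  assumes J: "countable J" "J \<noteq> {}"
    and g_measurable: "\<And>j. j \<in> J \<Longrightarrow> g j \<in> borel_measurable N"
    and g_bounded: "\<And>j x. j \<in> J \<Longrightarrow> x \<in> space N \<Longrightarrow> g j x \<in> {0..1}"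
begin

abbreviation "P I \<equiv> PiM I (\<lambda>_. N)"

definition signed_sup :: "'i set \<Rightarrow> ('i \<Rightarrow> real) \<Rightarrow> ('i \<Rightarrow> 'a) \<Rightarrow> real" where
  "signed_sup I e x = (SUP j\<in>J. \<bar>\<Sum>i\<in>I. e i * g j (x i)\<bar>)"

lemma prob_space_P: "prob_space (P I)"
  by (intro prob_space_PiM) unfold_locales

lemma g_component [measurable]:
  "j \<in> J \<Longrightarrow> i \<in> I \<Longrightarrow> (\<lambda>x. g j (x i)) \<in> borel_measurable (P I)"
  using g_measurable by (intro measurable_PiM_component_rev) auto

lemma g_component_bounded:
  "j \<in> J \<Longrightarrow> x \<in> space (P I) \<Longrightarrow> i \<in> I \<Longrightarrow> g j (x i) \<in> {0..1}"
  using g_bounded by (auto simp: space_PiM)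

lemma abs_sum_le_card:
  fixes h :: "'i \<Rightarrow> real"
  shows "(\<And>i. i \<in> I \<Longrightarrow> \<bar>h i\<bar> \<le> 1) \<Longrightarrow> \<bar>\<Sum>i\<in>I. h i\<bar> \<le> real (card I)"
  by (rule order_trans[OF sum_abs]) (use sum_bounded_above[of I "\<lambda>i. \<bar>h i\<bar>" 1] in auto)

lemma signed_term_bounded:
  assumes "\<And>i. i \<in> I \<Longrightarrow> \<bar>e i\<bar> \<le> 1" "j \<in> J" "x \<in> space (P I)"
  shows "\<bar>\<Sum>i\<in>I. e i * g j (x i)\<bar> \<le> real (card I)"
  using assms g_component_bounded[OF assms(2,3)]
  by (intro abs_sum_le_card) (auto simp: abs_mult intro!: mult_le_one)

lemma signed_sup_bounded:
  assumes "\<And>i. i \<in> I \<Longrightarrow> \<bar>e i\<bar> \<le> 1" "x \<in> space (P I)"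
  shows "signed_sup I e x \<in> {0..real (card I)}"
  unfolding signed_sup_def using assms J
  by (intro SUP_abs_bounded signed_term_bounded) auto

lemma signed_sup_measurable [measurable]:
  assumes "\<And>i. i \<in> I \<Longrightarrow> \<bar>e i\<bar> \<le> 1"
  shows "signed_sup I e \<in> borel_measurable (P I)" and "integrable (P I) (signed_sup I e)"
proof -
  interpret P: prob_space "P I" by (rule prob_space_P)
  have m: "(\<lambda>x. \<Sum>i\<in>I. e i * g j (x i)) \<in> borel_measurable (P I)" if "j \<in> J" for j
    using that by measurable
  have b: "\<bar>\<Sum>i\<in>I. e i * g j (x i)\<bar> \<le> real (card I)" if "j \<in> J" "x \<in> space (P I)" for j x
    using assms that by (rule signed_term_bounded)
  show "signed_sup I e \<in> borel_measurable (P I)" "integrable (P I) (signed_sup I e)"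
    unfolding signed_sup_def by (rule P.integrable_SUP_abs[OF J m b]; assumption)+
qed

text \<open>Coordinates of an i.i.d. family picked along an injection are again i.i.d. Used both to
  swap points within a doubled sample and to read either half of it as a sample.\<close>

lemma integral_P_reindex:
  fixes f :: "('i \<Rightarrow> 'a) \<Rightarrow> real"
  assumes "inj_on \<pi> I" "\<pi> \<in> I \<rightarrow> K" "f \<in> borel_measurable (P I)"
  shows "(\<integral>z. f (\<lambda>i\<in>I. z (\<pi> i)) \<partial>P K) = (\<integral>x. f x \<partial>P I)"
proof -
  have "(\<integral>x. f x \<partial>distr (P K) (P I) (\<lambda>z. \<lambda>i\<in>I. z (\<pi> i))) = (\<integral>z. f (\<lambda>i\<in>I. z (\<pi> i)) \<partial>P K)"
    using assms by (intro integral_distr) (auto intro!: measurable_restrict measurable_component_singleton)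
  moreover have "distr (P K) (P I) (\<lambda>z. \<lambda>i\<in>I. z (\<pi> i)) = P I"
    using assms by (intro distr_PiM_reindex) (auto intro: prob_space_axioms)
  ultimately show ?thesis by simp
qed

lemma integral_g_component:
  assumes "j \<in> J" "i \<in> I"
  shows "(\<integral>x. g j (x i) \<partial>P I) = (\<integral>x. g j x \<partial>N)"
proof -
  have "(\<integral>x. g j x \<partial>distr (P I) N (\<lambda>x. x i)) = (\<integral>x. g j (x i) \<partial>P I)"
    using assms g_measurable by (intro integral_distr) auto
  moreover have "distr (P I) N (\<lambda>x. x i) = N"
    using assms by (intro distr_PiM_component) (auto intro: prob_space_axioms)
  ultimately show ?thesis by simp
qed

lemma integrable_g_component: "j \<in> J \<Longrightarrow> i \<in> I \<Longrightarrow> integrable (P I) (\<lambda>x. g j (x i))"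
proof -
  assume *: "j \<in> J" "i \<in> I"
  interpret P: prob_space "P I" by (rule prob_space_P)
  show ?thesis
    using * g_component_bounded[OF *(1) _ *(2)]
    by (intro P.integrable_const_bound[of _ 1]) auto
qed

definition deviation :: "'i set \<Rightarrow> ('i \<Rightarrow> 'a) \<Rightarrow> real" where
  "deviation I x = (SUP j\<in>J. \<bar>\<Sum>i\<in>I. g j (x i) - (\<integral>y. g j y \<partial>N)\<bar>)"

text \<open>Index i + n is the ghost partner of i. Keeping both samples in one product over
  \<open>{1..2 * n}\<close> turns swapping partners into a permutation of coordinates. As in
  \<open>deviation\<close>, differences are summed over the sample, not averaged.\<close>

definition ghost_deviation :: "nat \<Rightarrow> (nat \<Rightarrow> real) \<Rightarrow> (nat \<Rightarrow> 'a) \<Rightarrow> real" where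
  "ghost_deviation n e z = (SUP j\<in>J. \<bar>\<Sum>i\<in>{1..n}. e i * (g j (z i) - g j (z (i + n)))\<bar>)"

lemma mean_bounded: "j \<in> J \<Longrightarrow> (\<integral>y. g j y \<partial>N) \<in> {0..1}"
proof -
  assume j: "j \<in> J"
  have "(\<integral>y. g j y \<partial>N) \<le> (\<integral>y. 1 \<partial>N)"
    using g_bounded[OF j] g_measurable[OF j]
    by (intro integral_mono integrable_const_bound[of _ 1]) auto
  then show ?thesis
    using g_bounded[OF j] by (auto simp: prob_space intro!: integral_nonneg_AE)
qed

lemma deviation_integrable: "finite I \<Longrightarrow> integrable (P I) (deviation I)"
proof -
  assume I: "finite I"
  interpret P: prob_space "P I" by (rule prob_space_P)
  show ?thesis
    unfolding deviation_def
  proof (intro P.integrable_SUP_abs J)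
    fix j x assume *: "j \<in> J" "x \<in> space (P I)"
    have "\<bar>g j (x i) - (\<integral>y. g j y \<partial>N)\<bar> \<le> 1" if "i \<in> I" for i
      using g_component_bounded[OF * that] mean_bounded[OF *(1)] by auto
    then show "\<bar>\<Sum>i\<in>I. g j (x i) - (\<integral>y. g j y \<partial>N)\<bar> \<le> real (card I)"
      by (intro abs_sum_le_card)
  qed auto
qed

lemma ghost_term_bounded:
  assumes "\<And>i. i \<in> {1..n} \<Longrightarrow> \<bar>e i\<bar> \<le> 1" and "j \<in> J" "z \<in> space (P {1..2 * n})"
  shows "\<bar>\<Sum>i\<in>{1..n}. e i * (g j (z i) - g j (z (i + n)))\<bar> \<le> real n"
proof -
  have "\<bar>e i * (g j (z i) - g j (z (i + n)))\<bar> \<le> 1" if "i \<in> {1..n}" for i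
    using assms(1)[OF that] that g_component_bounded[OF assms(2,3), of i]
      g_component_bounded[OF assms(2,3), of "i + n"]
    by (auto simp: abs_mult intro!: mult_le_one)
  then show ?thesis using abs_sum_le_card[of "{1..n}"] by simp
qed

lemma ghost_deviation_measurable:
  assumes "\<And>i. i \<in> {1..n} \<Longrightarrow> \<bar>e i\<bar> \<le> 1"
  shows "ghost_deviation n e \<in> borel_measurable (P {1..2 * n})"
    and "integrable (P {1..2 * n}) (ghost_deviation n e)"
proof -
  interpret P: prob_space "P {1..2 * n}" by (rule prob_space_P)
  have *: "(\<lambda>z. \<Sum>i\<in>{1..n}. e i * (g j (z i) - g j (z (i + n)))) \<in> borel_measurable (P {1..2 * n})"
    if "j \<in> J" for j
    using that by (intro borel_measurable_sum borel_measurable_times borel_measurable_diff g_component) auto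
  have b: "\<bar>\<Sum>i\<in>{1..n}. e i * (g j (z i) - g j (z (i + n)))\<bar> \<le> real n"
    if "j \<in> J" "z \<in> space (P {1..2 * n})" for j z
    using assms that by (rule ghost_term_bounded)
  show "ghost_deviation n e \<in> borel_measurable (P {1..2 * n})"
    and "integrable (P {1..2 * n}) (ghost_deviation n e)"
    unfolding ghost_deviation_def by (rule P.integrable_SUP_abs[OF J * b]; assumption)+
qed

text \<open>Each mean is an integral over the ghost half, and a supremum of absolute values of
  integrals is at most the integral of the supremum. Fubini along \<open>merge\<close> then joins
  the two halves.\<close>

lemma deviation_le_ghost:
  "(\<integral>x. deviation {1..n} x \<partial>P {1..n}) \<le> (\<integral>z. ghost_deviation n (\<lambda>_. 1) z \<partial>P {1..2 * n})"
proof -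
  let ?I = "{1..n}" and ?I' = "{Suc n..2 * n}"
  let ?D = "ghost_deviation n (\<lambda>_. 1)"
  interpret product_sigma_finite "\<lambda>_ :: nat. N" ..
  interpret P: prob_space "P ?I" by (rule prob_space_P)
  interpret P': prob_space "P ?I'" by (rule prob_space_P)
  have un: "?I \<union> ?I' = {1..2 * n}" by auto
  have mm: "merge ?I ?I' (x, y) \<in> space (P {1..2 * n})" if "x \<in> space (P ?I)" "y \<in> space (P ?I')" for x y
    using that unfolding un[symmetric] by (auto simp: space_PiM merge_def PiE_def extensional_def)
  have m[measurable]: "merge ?I ?I' \<in> measurable (P ?I \<Otimes>\<^sub>M P ?I') (P {1..2 * n})"
    using measurable_merge[of ?I ?I' "\<lambda>_. N"] by (simp only: un)
  have Dm: "(\<lambda>p. ?D (merge ?I ?I' p)) \<in> borel_measurable (P ?I \<Otimes>\<^sub>M P ?I')"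
    by (rule measurable_compose[OF m ghost_deviation_measurable(1)]) simp
  have Db: "?D z \<in> {0..real n}" if "z \<in> space (P {1..2 * n})" for z
    unfolding ghost_deviation_def using J that by (intro SUP_abs_bounded ghost_term_bounded) auto
  have Di: "integrable (P ?I') (\<lambda>y. ?D (merge ?I ?I' (x, y)))" if x: "x \<in> space (P ?I)" for x
  proof (rule P'.integrable_const_bound[of _ "real n"])
    show "AE y in P ?I'. norm (?D (merge ?I ?I' (x, y))) \<le> real n"
      using Db[OF mm[OF x]] by (intro AE_I2) auto
    show "(\<lambda>y. ?D (merge ?I ?I' (x, y))) \<in> borel_measurable (P ?I')"
      by (rule measurable_compose[OF measurable_Pair1'[OF x] Dm])
  qed
  have mg: "merge ?I ?I' (x, y) i = x i" "merge ?I ?I' (x, y) (i + n) = y (i + n)"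
    if "i \<in> ?I" for i x and y :: "nat \<Rightarrow> 'a"
    using that by (auto simp: merge_def)
  have "deviation ?I x \<le> (\<integral>y. ?D (merge ?I ?I' (x, y)) \<partial>P ?I')" if x: "x \<in> space (P ?I)" for x
    unfolding deviation_def
  proof (intro cSUP_least J)
    fix j assume j: "j \<in> J"
    have int: "integrable (P ?I') (\<lambda>y. \<Sum>i\<in>?I. g j (x i) - g j (y (i + n)))"
      using j by (intro Bochner_Integration.integrable_sum Bochner_Integration.integrable_diff
          P'.integrable_const integrable_g_component) auto
    have "(\<Sum>i\<in>?I. g j (x i) - (\<integral>y. g j y \<partial>N))
        = (\<Sum>i\<in>?I. \<integral>y. g j (x i) - g j (y (i + n)) \<partial>P ?I')"
    proof (intro sum.cong refl)
      fix i assume "i \<in> ?I"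
      then have "i + n \<in> ?I'" by auto
      then show "g j (x i) - (\<integral>y. g j y \<partial>N) = (\<integral>y. g j (x i) - g j (y (i + n)) \<partial>P ?I')"
        using j integrable_g_component[of j "i + n" ?I'] integral_g_component[of j "i + n" ?I']
        by (subst Bochner_Integration.integral_diff) (auto simp: P'.prob_space)
    qed
    also have "\<dots> = (\<integral>y. (\<Sum>i\<in>?I. g j (x i) - g j (y (i + n))) \<partial>P ?I')"
      using j by (intro Bochner_Integration.integral_sum[symmetric] Bochner_Integration.integrable_diff
          P'.integrable_const integrable_g_component) auto
    also have "\<bar>\<dots>\<bar> \<le> (\<integral>y. \<bar>\<Sum>i\<in>?I. g j (x i) - g j (y (i + n))\<bar> \<partial>P ?I')"
      by (rule integral_abs_bound)
    also have "\<dots> \<le> (\<integral>y. ?D (merge ?I ?I' (x, y)) \<partial>P ?I')"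
    proof (intro integral_mono integrable_abs int)
      show "integrable (P ?I') (\<lambda>y. ?D (merge ?I ?I' (x, y)))"
        by (rule Di[OF x])
    next
      fix y assume y: "y \<in> space (P ?I')"
      let ?z = "merge ?I ?I' (x, y)"
      have eq: "(\<Sum>i\<in>?I. 1 * (g j (?z i) - g j (?z (i + n)))) = (\<Sum>i\<in>?I. g j (x i) - g j (y (i + n)))"
        by (intro sum.cong) (simp_all add: mg)
      have "\<bar>\<Sum>i\<in>?I. 1 * (g j (?z i) - g j (?z (i + n)))\<bar> \<le> ?D ?z"
        unfolding ghost_deviation_def using j mm[OF x y]
        by (intro cSUP_upper SUP_abs_bounded(1)[where B = "real n"] J ghost_term_bounded) auto
      then show "\<bar>\<Sum>i\<in>?I. g j (x i) - g j (y (i + n))\<bar> \<le> ?D ?z"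
        by (simp only: eq)
    qed
    finally show "\<bar>\<Sum>i\<in>?I. g j (x i) - (\<integral>y. g j y \<partial>N)\<bar> \<le> (\<integral>y. ?D (merge ?I ?I' (x, y)) \<partial>P ?I')" .
  qed
  moreover have "integrable (P ?I) (\<lambda>x. \<integral>y. ?D (merge ?I ?I' (x, y)) \<partial>P ?I')"
  proof (rule P.integrable_const_bound[of _ "real n"])
    have "\<bar>\<integral>y. ?D (merge ?I ?I' (x, y)) \<partial>P ?I'\<bar> \<le> real n" if x: "x \<in> space (P ?I)" for x
    proof -
      have "\<bar>\<integral>y. ?D (merge ?I ?I' (x, y)) \<partial>P ?I'\<bar> \<le> (\<integral>y. \<bar>?D (merge ?I ?I' (x, y))\<bar> \<partial>P ?I')"
        by (rule integral_abs_bound)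
      also have "\<dots> \<le> (\<integral>y. real n \<partial>P ?I')"
        using Db[OF mm[OF x]]
        by (intro integral_mono integrable_abs P'.integrable_const Di x) auto
      finally show ?thesis by (simp add: P'.prob_space)
    qed
    then show "AE x in P ?I. norm (\<integral>y. ?D (merge ?I ?I' (x, y)) \<partial>P ?I') \<le> real n"
      by auto
    show "(\<lambda>x. \<integral>y. ?D (merge ?I ?I' (x, y)) \<partial>P ?I') \<in> borel_measurable (P ?I)"
    proof (rule P'.borel_measurable_lebesgue_integral)
      have "(\<lambda>(x, y). ?D (merge ?I ?I' (x, y))) = (\<lambda>p. ?D (merge ?I ?I' p))"
        by (rule case_prod_eta)
      then show "(\<lambda>(x, y). ?D (merge ?I ?I' (x, y))) \<in> borel_measurable (P ?I \<Otimes>\<^sub>M P ?I')"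
        by (rule ssubst) (rule Dm)
    qed
  qed
  ultimately have "(\<integral>x. deviation ?I x \<partial>P ?I) \<le> (\<integral>x. (\<integral>y. ?D (merge ?I ?I' (x, y)) \<partial>P ?I') \<partial>P ?I)"
    by (intro integral_mono deviation_integrable) auto
  also have "\<dots> = (\<integral>z. ?D z \<partial>P (?I \<union> ?I'))"
    by (intro product_integral_fold[symmetric])
       (use ghost_deviation_measurable(2)[of n "\<lambda>_. 1"] in \<open>auto simp: un simp del: One_nat_def\<close>)
  finally show ?thesis by (simp only: un)
qed

text \<open>Exchanging a point with its ghost partner preserves the product measure and negates the
  corresponding difference, which is exactly what a sign -1 does.\<close>

lemma ghost_deviation_flip:
  assumes e: "e \<in> {1..n} \<rightarrow>\<^sub>E {- 1, 1}"
  shows "(\<integral>z. ghost_deviation n e z \<partial>P {1..2 * n}) = (\<integral>z. ghost_deviation n (\<lambda>_. 1) z \<partial>P {1..2 * n})"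
proof -
  let ?K = "{1..2 * n}"
  \<comment> \<open>The involution that exchanges k and k + n precisely where the sign is -1; the
    second branch undoes the first.\<close>
  define \<pi> where "\<pi> k = (if k \<in> {1..n} \<and> e k = - 1 then k + n
      else if k \<in> {Suc n..2*n} \<and> e (k - n) = - 1 then k - n else k)" for k
  have \<pi>: "\<pi> k \<in> ?K" "\<pi> (\<pi> k) = k" if "k \<in> ?K" for k
    using that by (auto simp: \<pi>_def)
  have "inj_on \<pi> ?K" by (rule inj_on_inverseI[of _ \<pi>]) (use \<pi> in auto)
  then have "(\<integral>z. ghost_deviation n (\<lambda>_. 1) (\<lambda>k\<in>?K. z (\<pi> k)) \<partial>P ?K)
      = (\<integral>z. ghost_deviation n (\<lambda>_. 1) z \<partial>P ?K)"
    using \<pi>(1) by (intro integral_P_reindex ghost_deviation_measurable) auto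
  moreover have "ghost_deviation n (\<lambda>_. 1) (\<lambda>k\<in>?K. z (\<pi> k)) = ghost_deviation n e z" for z
  proof -
    have "1 * (g j ((\<lambda>k\<in>?K. z (\<pi> k)) i) - g j ((\<lambda>k\<in>?K. z (\<pi> k)) (i + n)))
        = e i * (g j (z i) - g j (z (i + n)))" if i: "i \<in> {1..n}" for i j
    proof -
      have "e i = - 1 \<or> e i = 1" using PiE_mem[OF e i] by auto
      then show ?thesis using i by (auto simp: \<pi>_def)
    qed
    then show ?thesis
      unfolding ghost_deviation_def by (intro SUP_cong refl arg_cong[where f = abs] sum.cong)
  qed
  ultimately show ?thesis by simp
qed

lemma signs_abs_le: "e \<in> I \<rightarrow>\<^sub>E {- 1, 1 :: real} \<Longrightarrow> i \<in> I \<Longrightarrow> \<bar>e i\<bar> \<le> 1"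
  by (drule (1) PiE_mem) auto

text \<open>The triangle inequality separates the two halves, each distributed as a sample of size
  n. This is the factor 2 of symmetrization.\<close>

lemma ghost_deviation_le_signed_sup:
  assumes e: "\<And>i. i \<in> {1..n} \<Longrightarrow> \<bar>e i\<bar> \<le> 1"
  shows "(\<integral>z. ghost_deviation n e z \<partial>P {1..2 * n}) \<le> 2 * (\<integral>x. signed_sup {1..n} e x \<partial>P {1..n})"
proof -
  let ?I = "{1..n}" and ?K = "{1..2 * n}"
  interpret P: prob_space "P ?K" by (rule prob_space_P)
  let ?u = "\<lambda>z. \<lambda>i\<in>?I. z i" and ?v = "\<lambda>z. \<lambda>i\<in>?I. z (i + n)"
  have sp: "?u z \<in> space (P ?I)" "?v z \<in> space (P ?I)" if "z \<in> space (P ?K)" for z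
    using that by (auto simp: space_PiM PiE_def Pi_def)
  have [measurable]: "?u \<in> measurable (P ?K) (P ?I)" "?v \<in> measurable (P ?K) (P ?I)"
    by (auto intro!: measurable_restrict measurable_component_singleton)
  have int: "integrable (P ?K) (\<lambda>z. signed_sup ?I e (w z))"
    if [measurable]: "w \<in> measurable (P ?K) (P ?I)" for w
    using signed_sup_bounded[OF e, of ?I] measurable_space[OF that] measurable_compose[OF that signed_sup_measurable(1)[OF e]]
    by (intro P.integrable_const_bound[of _ "real n"]) (auto simp: comp_def)
  have "ghost_deviation n e z \<le> signed_sup ?I e (?u z) + signed_sup ?I e (?v z)"
    if z: "z \<in> space (P ?K)" for z
    unfolding ghost_deviation_def
  proof (intro cSUP_least J)
    fix j assume j: "j \<in> J"
    have up: "\<bar>\<Sum>i\<in>?I. e i * g j (x i)\<bar> \<le> signed_sup ?I e x" if "x \<in> space (P ?I)" for x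
      unfolding signed_sup_def using j that e
      by (intro cSUP_upper SUP_abs_bounded(1)[where B = "real (card ?I)"] J signed_term_bounded) auto
    have "(\<Sum>i\<in>?I. e i * (g j (z i) - g j (z (i + n))))
        = (\<Sum>i\<in>?I. e i * g j (?u z i)) - (\<Sum>i\<in>?I. e i * g j (?v z i))"
      by (simp add: sum_subtractf right_diff_distrib)
    then show "\<bar>\<Sum>i\<in>?I. e i * (g j (z i) - g j (z (i + n)))\<bar> \<le> signed_sup ?I e (?u z) + signed_sup ?I e (?v z)"
      using up[OF sp(1)[OF z]] up[OF sp(2)[OF z]] by linarith
  qed
  then have "(\<integral>z. ghost_deviation n e z \<partial>P ?K)
      \<le> (\<integral>z. signed_sup ?I e (?u z) + signed_sup ?I e (?v z) \<partial>P ?K)"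
    by (intro integral_mono Bochner_Integration.integrable_add int ghost_deviation_measurable e) auto
  also have "\<dots> = (\<integral>z. signed_sup ?I e (?u z) \<partial>P ?K) + (\<integral>z. signed_sup ?I e (?v z) \<partial>P ?K)"
    by (intro Bochner_Integration.integral_add int) auto
  also have "(\<integral>z. signed_sup ?I e (?u z) \<partial>P ?K) = (\<integral>x. signed_sup ?I e x \<partial>P ?I)"
    by (intro integral_P_reindex signed_sup_measurable e) auto
  also have "(\<integral>z. signed_sup ?I e (?v z) \<partial>P ?K) = (\<integral>x. signed_sup ?I e x \<partial>P ?I)"
    by (intro integral_P_reindex signed_sup_measurable e) auto
  finally show ?thesis by simp
qed

abbreviation emp_rademacher :: "'i set \<Rightarrow> ('i \<Rightarrow> 'a) \<Rightarrow> real" where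
  "emp_rademacher I x \<equiv> rademacher_avg I J (\<lambda>i j. g j (x i))"

lemma emp_rademacher_eq:
  "emp_rademacher I x = (\<Sum>e\<in>I \<rightarrow>\<^sub>E {- 1, 1}. signed_sup I e x) / 2 ^ card I"
  by (simp add: rademacher_avg_def signed_sup_def)

text \<open>The ghost bound holds for every fixed sign vector, hence also for the average over all
  of them.\<close>

theorem symmetrization:
  fixes n :: nat
  shows "(\<integral>x. deviation {1..n} x \<partial>P {1..n}) \<le> 2 * (\<integral>x. emp_rademacher {1..n} x \<partial>P {1..n})"
proof -
  let ?E = "{1..n} \<rightarrow>\<^sub>E {- 1, 1 :: real}"
  let ?d = "\<integral>x. deviation {1..n} x \<partial>P {1..n}"
  have "?d \<le> 2 * (\<integral>x. signed_sup {1..n} e x \<partial>P {1..n})" if "e \<in> ?E" for e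
  proof -
    have "(\<integral>z. ghost_deviation n e z \<partial>P {1..2 * n}) \<le> 2 * (\<integral>x. signed_sup {1..n} e x \<partial>P {1..n})"
      by (rule ghost_deviation_le_signed_sup) (rule signs_abs_le[OF that])
    then show ?thesis
      using deviation_le_ghost[of n] ghost_deviation_flip[OF that] by simp
  qed
  then have "(\<Sum>e\<in>?E. ?d) \<le> (\<Sum>e\<in>?E. 2 * (\<integral>x. signed_sup {1..n} e x \<partial>P {1..n}))"
    by (rule sum_mono)
  also have "\<dots> = 2 * (\<integral>x. (\<Sum>e\<in>?E. signed_sup {1..n} e x) \<partial>P {1..n})"
    using signs_abs_le[of _ "{1..n}"]
    by (subst Bochner_Integration.integral_sum) (auto simp: sum_distrib_left intro!: signed_sup_measurable(2))
  finally have "2 ^ n * ?d \<le> 2 * (\<integral>x. (\<Sum>e\<in>?E. signed_sup {1..n} e x) \<partial>P {1..n})"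
    by (simp add: card_signs)
  then show ?thesis
    by (simp add: emp_rademacher_eq field_simps)
qed

section \<open>Concentration of the empirical Rademacher average\<close>

lemma emp_rademacher_measurable [measurable]: "emp_rademacher I \<in> borel_measurable (P I)"
  unfolding emp_rademacher_eq using signs_abs_le[of _ I]
  by (intro borel_measurable_divide borel_measurable_sum signed_sup_measurable(1)) auto

lemma avg_signs_le:
  fixes h :: "('i \<Rightarrow> real) \<Rightarrow> real"
  assumes "finite I" "\<And>e. e \<in> I \<rightarrow>\<^sub>E {- 1, 1 :: real} \<Longrightarrow> \<bar>h e\<bar> \<le> c"
  shows "\<bar>(\<Sum>e\<in>I \<rightarrow>\<^sub>E {- 1, 1}. h e) / 2 ^ card I\<bar> \<le> c"
proof -
  have "\<bar>\<Sum>e\<in>I \<rightarrow>\<^sub>E {- 1, 1}. h e\<bar> \<le> (\<Sum>e\<in>I \<rightarrow>\<^sub>E {- 1, 1}. \<bar>h e\<bar>)"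
    by (rule sum_abs)
  also have "\<dots> \<le> 2 ^ card I * c"
    using sum_bounded_above[of "I \<rightarrow>\<^sub>E {- 1, 1}" "\<lambda>e. \<bar>h e\<bar>" c] assms by (simp add: card_signs)
  finally show ?thesis by (simp add: field_simps)
qed

lemma emp_rademacher_bounded:
  fixes x :: "'i \<Rightarrow> 'a"
  assumes "finite I" "x \<in> space (P I)"
  shows "\<bar>emp_rademacher I x\<bar> \<le> real (card I)"
  unfolding emp_rademacher_eq
proof (rule avg_signs_le[OF assms(1)])
  fix e :: "'i \<Rightarrow> real" assume "e \<in> I \<rightarrow>\<^sub>E {- 1, 1}"
  then have "signed_sup I e x \<in> {0..real (card I)}"
    using assms by (intro signed_sup_bounded signs_abs_le)
  then show "\<bar>signed_sup I e x\<bar> \<le> real (card I)" by simp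
qed

text \<open>Replacing one point changes a single term e i * g j (x i) of each signed sum, by at most
  1 because g has values in [0,1]. Supremum and averaging over signs preserve this.\<close>

lemma emp_rademacher_bounded_differences:
  assumes I: "finite I" and x: "x \<in> space (P I)" and i: "i \<in> I" and y: "y \<in> space N"
  shows "\<bar>emp_rademacher I (x(i := y)) - emp_rademacher I x\<bar> \<le> 1"
proof -
  have x': "x(i := y) \<in> space (P I)"
    using x i y by (auto simp: space_PiM PiE_def extensional_def)
  have "\<bar>signed_sup I e (x(i := y)) - signed_sup I e x\<bar> \<le> 1" if e: "e \<in> I \<rightarrow>\<^sub>E {- 1, 1}" for e
    unfolding signed_sup_def
  proof (intro SUP_abs_diff_le[where A = "real (card I)" and B = "real (card I)"]
      signed_term_bounded signs_abs_le[OF e] x x' J)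
    fix j assume j: "j \<in> J"
    have eq: "(\<Sum>k\<in>I. e k * g j ((x(i := y)) k)) - (\<Sum>k\<in>I. e k * g j (x k))
        = e i * (g j y - g j (x i))"
      using I i by (simp add: sum.remove[of I i] right_diff_distrib)
    have "\<bar>e i * (g j y - g j (x i))\<bar> \<le> 1"
      using signs_abs_le[OF e i] g_bounded[OF j y] g_component_bounded[OF j x i]
      by (auto simp: abs_mult intro!: mult_le_one)
    then show "\<bar>(\<Sum>k\<in>I. e k * g j ((x(i := y)) k)) - (\<Sum>k\<in>I. e k * g j (x k))\<bar> \<le> 1"
      by (simp only: eq)
  qed
  then have "\<bar>(\<Sum>e\<in>I \<rightarrow>\<^sub>E {- 1, 1}. signed_sup I e (x(i := y)) - signed_sup I e x) / 2 ^ card I\<bar> \<le> 1"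
    by (rule avg_signs_le[OF I])
  then show ?thesis
    by (simp only: emp_rademacher_eq sum_subtractf diff_divide_distrib)
qed

theorem deviation_le_emp_rademacher:
  fixes n :: nat
  assumes n: "n \<ge> 1" and \<delta>: "0 < \<delta>" "\<delta> < 1"
  shows "measure (P {1..n}) {x \<in> space (P {1..n}).
           (\<integral>x. deviation {1..n} x \<partial>P {1..n}) \<le> 2 * emp_rademacher {1..n} x + sqrt (8 * real n * ln (1 / \<delta>))}
         \<ge> 1 - \<delta>"
proof -
  let ?P = "P {1..n}" and ?R = "emp_rademacher {1..n}"
  interpret P: prob_space ?P by (rule prob_space_P)
  \<comment> \<open>Chosen so that the tail bound exp (- t^2 / (2 n)) equals \<delta>.
    Symmetrization doubles the fluctuation, so 2 t is what appears in the result.\<close>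
  define t where "t = sqrt (2 * real n * ln (1 / \<delta>))"
  have L: "ln (1 / \<delta>) > 0" using \<delta> by simp
  then have t: "t > 0" "t\<^sup>2 = 2 * real n * ln (1 / \<delta>)" using n by (auto simp: t_def)
  have t2: "2 * t = sqrt (8 * real n * ln (1 / \<delta>))"
    using real_sqrt_mult[of 4 "2 * real n * ln (1 / \<delta>)"] by (simp add: t_def mult.assoc)
  let ?B = "{x \<in> space ?P. (\<integral>x. ?R x \<partial>?P) - ?R x \<ge> t}"
  have B: "?B \<in> P.events" by measurable
  have "P.prob ?B \<le> exp (- t\<^sup>2 / (2 * real (card {1..n}) * 1\<^sup>2))"
    using t n by (intro bounded_differences_lower_tail[where B = "real n"] prob_space_axioms)
      (use emp_rademacher_bounded[of "{1..n}"] emp_rademacher_bounded_differences[of "{1..n}"] in auto)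
  also have "- t\<^sup>2 / (2 * real (card {1..n}) * 1\<^sup>2) = ln \<delta>"
    using n \<delta> t by (simp add: ln_div)
  finally have "P.prob ?B \<le> \<delta>" using \<delta> by simp
  then have "1 - \<delta> \<le> P.prob (space ?P - ?B)"
    using P.prob_compl[OF B] by simp
  also have "\<dots> \<le> P.prob {x \<in> space ?P. (\<integral>x. deviation {1..n} x \<partial>?P) \<le> 2 * ?R x + sqrt (8 * real n * ln (1 / \<delta>))}"
  proof (intro P.finite_measure_mono)
    show "space ?P - ?B \<subseteq> {x \<in> space ?P. (\<integral>x. deviation {1..n} x \<partial>?P) \<le> 2 * ?R x + sqrt (8 * real n * ln (1 / \<delta>))}"
      using symmetrization[of n] t2 by auto
  qed measurable
  finally show ?thesis .
qed

end


section \<open>Decreasing rearrangements\<close>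

text \<open>With finitely many values the \<open>GREATEST\<close> is a \<open>Max\<close> over a
  finite set of candidates, nonempty because the least entry over any j indices is itself a
  candidate. Superlevel sets in this form serve both measurability and comparison of ranks.\<close>

lemma jth_largest_greater_iff:
  assumes fin: "finite (u ` {1..})" and j: "j \<ge> 1"
  shows "c < jth_largest u j \<longleftrightarrow>
           (\<exists>F\<subseteq>{1..}. finite F \<and> card F = j \<and> (\<forall>i\<in>F. c < u i))"
proof -
  define A where "A = {t \<in> u ` {1..}. \<exists>F\<subseteq>{1..}. finite F \<and> card F = j \<and> (\<forall>i\<in>F. t \<le> u i)}"
  have A: "finite A" using fin by (simp add: A_def)
  have Min_A: "Min (u ` F) \<in> A" if F: "F \<subseteq> {1..}" "finite F" "card F = j" for F
  proof -
    have "F \<noteq> {}" using F j by auto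
    then have "Min (u ` F) \<in> u ` F" using F by (intro Min_in) auto
    moreover have "u ` F \<subseteq> u ` {1..}" using F by auto
    moreover have "\<forall>i\<in>F. Min (u ` F) \<le> u i" using F by auto
    ultimately show ?thesis unfolding A_def using F by blast
  qed
  have "Min (u ` {1..j}) \<in> A" by (intro Min_A) auto
  then have ne: "A \<noteq> {}" by auto
  have eq: "jth_largest u j = Max A"
    unfolding jth_largest_def
  proof (rule Greatest_equality)
    show "Max A \<in> u ` {1..} \<and> (\<exists>F\<subseteq>{1..}. finite F \<and> card F = j \<and> (\<forall>i\<in>F. Max A \<le> u i))"
      using Max_in[OF A ne] unfolding A_def by auto
    show "t \<le> Max A"
      if "t \<in> u ` {1..} \<and> (\<exists>F\<subseteq>{1..}. finite F \<and> card F = j \<and> (\<forall>i\<in>F. t \<le> u i))" for t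
      using A that by (intro Max_ge) (auto simp: A_def)
  qed
  show ?thesis
  proof
    assume c: "c < jth_largest u j"
    have "Max A \<in> A" using A ne by simp
    then obtain F where F: "F \<subseteq> {1..}" "finite F" "card F = j" "\<forall>i\<in>F. Max A \<le> u i"
      unfolding A_def by blast
    then show "\<exists>F\<subseteq>{1..}. finite F \<and> card F = j \<and> (\<forall>i\<in>F. c < u i)"
      using c by (intro exI[of _ F]) (auto simp: eq)
  next
    assume "\<exists>F\<subseteq>{1..}. finite F \<and> card F = j \<and> (\<forall>i\<in>F. c < u i)"
    then obtain F where F: "F \<subseteq> {1..}" "finite F" "card F = j" "\<forall>i\<in>F. c < u i" by blast
    then have "F \<noteq> {}" using j by auto
    then have "c < Min (u ` F)" using F by simp
    also have "\<dots> \<le> Max A" using A Min_A[OF F(1-3)] by simp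
    finally show "c < jth_largest u j" by (simp add: eq)
  qed
qed

lemma jth_largest_nonneg:
  assumes "finite (u ` {1..})" "j \<ge> 1" "\<And>i. i \<ge> 1 \<Longrightarrow> u i \<ge> 0"
  shows "jth_largest u j \<ge> 0"
proof (rule ccontr)
  assume neg: "\<not> ?thesis"
  have "\<forall>i\<in>{1..j}. jth_largest u j < u i"
    using neg assms(3) by (force simp: not_le)
  then have "jth_largest u j < jth_largest u j"
    using assms by (subst jth_largest_greater_iff) (auto intro!: exI[of _ "{1..j}"])
  then show False by simp
qed

text \<open>A superlevel set is a union over the j-element subsets of the index set, and there are
  only countably many of these.\<close>

lemma jth_largest_measurable:
  assumes fin: "\<And>x. x \<in> space M \<Longrightarrow> finite (u x ` {1..})" and j: "j \<ge> 1"
    and m: "\<And>i. i \<ge> 1 \<Longrightarrow> (\<lambda>x. u x i) \<in> borel_measurable M"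
  shows "(\<lambda>x. jth_largest (u x) j) \<in> borel_measurable M"
proof (subst borel_measurable_iff_greater, intro allI)
  fix c :: real
  let ?C = "{F. finite F \<and> F \<subseteq> {1 :: nat..}}"
  have "countable ?C" by (rule countable_Collect_finite_subset) simp
  then have C: "countable {F \<in> ?C. card F = j}"
    by (rule countable_subset[rotated]) auto
  have "{x \<in> space M. c < jth_largest (u x) j}
      = (\<Union>F\<in>{F \<in> ?C. card F = j}. {x \<in> space M. \<forall>i\<in>F. c < u x i})"
    using jth_largest_greater_iff[OF fin j] by auto
  also have "\<dots> \<in> sets M"
  proof (rule sets.countable_UN''[OF C])
    fix F assume "F \<in> {F \<in> ?C. card F = j}"
    then have F: "finite F" "\<And>i. i \<in> F \<Longrightarrow> i \<ge> 1" by auto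
    show "{x \<in> space M. \<forall>i\<in>F. c < u x i} \<in> sets M"
      using F m by (intro sets.sets_Collect_finite_All borel_measurable_less borel_measurable_const) auto
  qed
  finally show "{x \<in> space M. c < jth_largest (u x) j} \<in> sets M" .
qed

lemma LIMSEQ_0_measurable:
  fixes u :: "'a \<Rightarrow> nat \<Rightarrow> real"
  assumes [measurable]: "\<And>i. (\<lambda>x. u x i) \<in> borel_measurable M"
  shows "Measurable.pred M (\<lambda>x. u x \<longlonglongrightarrow> 0)"
proof -
  have "u x \<longlonglongrightarrow> 0 \<longleftrightarrow> (\<forall>k::nat. \<exists>N. \<forall>i. N \<le> i \<longrightarrow> \<bar>u x i\<bar> < inverse (real (Suc k)))" for x
  proof
    assume "u x \<longlonglongrightarrow> 0"
    then show "\<forall>k::nat. \<exists>N. \<forall>i. N \<le> i \<longrightarrow> \<bar>u x i\<bar> < inverse (real (Suc k))"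
      using LIMSEQ_D[of "u x" 0 "inverse (real (Suc k))" for k] by simp
  next
    assume *: "\<forall>k::nat. \<exists>N. \<forall>i. N \<le> i \<longrightarrow> \<bar>u x i\<bar> < inverse (real (Suc k))"
    show "u x \<longlonglongrightarrow> 0"
    proof (rule LIMSEQ_I)
      fix r :: real assume "r > 0"
      then obtain k where "inverse (real (Suc k)) < r" using reals_Archimedean by blast
      with * show "\<exists>N. \<forall>i\<ge>N. norm (u x i - 0) < r" by (metis order.strict_trans real_norm_def diff_zero)
    qed
  qed
  then show ?thesis by simp
qed

lemma S_opt_decr_rearrangement:
  "S_opt (decr_rearrangement u) = (if u \<longlonglongrightarrow> 0 then S (jth_largest u) else \<infinity>)"
  by (simp add: S_opt_def decr_rearrangement_def)

lemma S_opt_decr_rearrangement_measurable: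
  assumes fin: "\<And>x. x \<in> space M \<Longrightarrow> finite (u x ` {1..})"
    and m: "\<And>i. i \<ge> 1 \<Longrightarrow> (\<lambda>x. u x i) \<in> borel_measurable M"
  shows "(\<lambda>x. S_opt (decr_rearrangement (u x))) \<in> borel_measurable M"
proof -
  \<comment> \<open>Nothing is known about the entry at 0, which lies outside the index set;
    shifting by one drops it without affecting the limit.\<close>
  have "Measurable.pred M (\<lambda>x. (\<lambda>i. u x (Suc i)) \<longlonglongrightarrow> 0)"
    by (intro LIMSEQ_0_measurable m) simp
  then have [measurable]: "Measurable.pred M (\<lambda>x. u x \<longlonglongrightarrow> 0)"
    by (simp add: filterlim_sequentially_Suc)
  have [measurable]: "(\<lambda>x. S (jth_largest (u x))) \<in> borel_measurable M"
    unfolding S_def using jth_largest_measurable[OF fin _ m]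
    by (intro borel_measurable_SUP borel_measurable_ereal borel_measurable_times) auto
  show ?thesis
    unfolding S_opt_decr_rearrangement by measurable
qed

lemma ereal_sqrt_measurable [measurable]: "ereal_sqrt \<in> borel_measurable borel"
  unfolding ereal_sqrt_def by measurable

text \<open>Column means of a bit matrix are multiples of 1/n, so a nonzero one is at least 1/n, and
  convergence to 0 leaves only finitely many nonzero columns. Listed in decreasing order, they
  satisfy the hypothesis of the maximal inequality with n V in place of V.\<close>

lemma rademacher_avg_le_S:
  assumes n: "n \<ge> 1"
    and w: "\<And>i j. i \<in> {1..n} \<Longrightarrow> j \<ge> 1 \<Longrightarrow> w i j \<in> {0, 1 :: real}"
    and u: "\<And>j. j \<ge> 1 \<Longrightarrow> u j = (\<Sum>i=1..n. w i j) / real n"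
    and fin: "S_opt (decr_rearrangement u) \<noteq> \<infinity>"
  obtains V where "V \<ge> 0" "S_opt (decr_rearrangement u) = ereal V"
    "rademacher_avg {1..n} {1..} w \<le> 4 * sqrt (real n * V)"
proof -
  have lim: "u \<longlonglongrightarrow> 0" and S_opt: "S_opt (decr_rearrangement u) = S (jth_largest u)"
    using fin by (auto simp: S_opt_decr_rearrangement split: if_splits)
  have card: "(\<Sum>i=1..n. w i j) = real (card {i \<in> {1..n}. w i j = 1})" if "j \<ge> 1" for j
  proof -
    have "(\<Sum>i=1..n. w i j) = (\<Sum>i=1..n. if w i j = 1 then 1 else 0)"
      using w that by (intro sum.cong) (auto split: if_splits)
    then show ?thesis by (simp add: sum.If_cases Int_def)
  qed
  have "u ` {1..} \<subseteq> (\<lambda>k. real k / real n) ` {..n}"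
  proof safe
    fix j :: nat assume "1 \<le> j"
    moreover have "card {i \<in> {1..n}. w i j = 1} \<le> card {1..n}"
      by (intro card_mono) auto
    ultimately show "u j \<in> (\<lambda>k. real k / real n) ` {..n}"
      using card u by (intro image_eqI[of _ _ "card {i \<in> {1..n}. w i j = 1}"]) auto
  qed
  then have ran: "finite (u ` {1..})" by (rule finite_subset) simp
  have u0: "u j \<ge> 0" if "j \<ge> 1" for j using that u card by simp
  have gap: "u j \<ge> 1 / real n" if "j \<ge> 1" "u j \<noteq> 0" for j
  proof -
    have "card {i \<in> {1..n}. w i j = 1} \<noteq> 0" using that u[of j] card[of j] by auto
    then have "real (card {i \<in> {1..n}. w i j = 1}) \<ge> 1" by linarith
    then show ?thesis unfolding u[OF that(1)] card[OF that(1)] by (rule divide_right_mono) simp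
  qed
  define K where "K = {j. j \<ge> 1 \<and> u j \<noteq> 0}"
  have "finite K"
  proof -
    from LIMSEQ_D[OF lim, of "1 / real n"] n
    obtain N where N: "\<And>j. j \<ge> N \<Longrightarrow> \<bar>u j\<bar> < 1 / real n" by auto
    have "j < N" if "j \<in> K" for j
    proof (rule ccontr)
      assume "\<not> j < N"
      then show False using N[of j] gap[of j] that by (simp add: K_def)
    qed
    then have "K \<subseteq> {..<N}" by auto
    then show ?thesis by (rule finite_subset) simp
  qed
  define xs where "xs = sort_key (\<lambda>j. - u j) (sorted_list_of_set K)"
  have xs: "set xs = K" "distinct xs" "sorted (map (\<lambda>j. - u j) xs)"
    using \<open>finite K\<close> by (simp_all add: xs_def)
  \<comment> \<open>List positions start at 0 and ranks at 1. The first k + 1 entries of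
    \<open>xs\<close> are distinct indices whose means are at least u (xs ! k), so the value of rank
    k + 1 cannot be smaller.\<close>
  have rank: "u (xs ! k) \<le> jth_largest u (Suc k)" if k: "k < length xs" for k
  proof (rule ccontr)
    assume neg: "\<not> ?thesis"
    have "jth_largest u (Suc k) < u (xs ! l)" if "l < Suc k" for l
      using sorted_nth_mono[OF xs(3), of l k] that k neg by simp
    then have "\<forall>i\<in>set (take (Suc k) xs). jth_largest u (Suc k) < u i"
      by (auto simp: in_set_conv_nth)
    moreover have "set (take (Suc k) xs) \<subseteq> {1..}"
      using xs(1) set_take_subset[of "Suc k" xs] by (auto simp: K_def)
    moreover have "card (set (take (Suc k) xs)) = Suc k"
      using xs(2) k by (subst distinct_card) auto
    ultimately have "jth_largest u (Suc k) < jth_largest u (Suc k)"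
      using ran by (subst jth_largest_greater_iff) (auto intro!: exI[of _ "set (take (Suc k) xs)"])
    then show False by simp
  qed
  have S_ge: "ereal (jth_largest u j * ln (real j + 1)) \<le> S (jth_largest u)" if "j \<ge> 1" for j
    unfolding S_def using that by (intro SUP_upper) auto
  \<comment> \<open>The first term already makes the supremum nonnegative, which excludes
    -\<infinity> and gives V \<ge> 0.\<close>
  have "0 \<le> ereal (jth_largest u 1 * ln (real 1 + 1))"
    using jth_largest_nonneg[OF ran _ u0] by simp
  also note S_ge[of 1]
  finally have "0 \<le> S (jth_largest u)" by simp
  then obtain V where V: "S (jth_largest u) = ereal V" "V \<ge> 0"
    using fin unfolding S_opt by (cases "S (jth_largest u)") auto
  have "rademacher_avg {1..n} {1..} w \<le> 4 * sqrt (real n * V)"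
  proof (rule rademacher_avg_le[where xs = xs])
    show "w i j \<in> {0..1}" if "i \<in> {1..n}" "j \<in> {1..}" for i j
      using w[of i j] that by auto
    show "w i j = 0" if "i \<in> {1..n}" "j \<in> {1..} - set xs" for i j
    proof -
      have j: "j \<ge> 1" "u j = 0" using that xs(1) by (auto simp: K_def)
      then have "card {i \<in> {1..n}. w i j = 1} = 0" using u[of j] card[of j] n by simp
      then have "w i j \<noteq> 1" using that by auto
      then show ?thesis using w[OF that(1) j(1)] by auto
    qed
    show "(\<Sum>i\<in>{1..n}. w i (xs ! k)) * ln (real k + 2) \<le> real n * V" if k: "k < length xs" for k
    proof -
      have "xs ! k \<in> K" using k xs(1) by auto
      then have "(\<Sum>i\<in>{1..n}. w i (xs ! k)) = real n * u (xs ! k)"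
        using u n by (simp add: K_def)
      also have "\<dots> \<le> real n * jth_largest u (Suc k)"
        by (intro mult_left_mono rank k) simp
      finally have "(\<Sum>i\<in>{1..n}. w i (xs ! k)) * ln (real k + 2)
          \<le> real n * jth_largest u (Suc k) * ln (real k + 2)"
        by (intro mult_right_mono) auto
      also have "\<dots> = real n * (jth_largest u (Suc k) * ln (real (Suc k) + 1))"
        by (simp add: add.commute)
      also have "\<dots> \<le> real n * V"
        using S_ge[of "Suc k"] V by (intro mult_left_mono) auto
      finally show ?thesis .
    qed
  qed (use xs V in \<open>auto simp: K_def\<close>)
  with V S_opt show ?thesis using that by simp
qed


section \<open>Flipped samples\<close>

lemma SUP_mult_left_real:
  fixes f :: "'j \<Rightarrow> real"
  assumes "c > 0" "J \<noteq> {}" "bdd_above (f ` J)"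
  shows "(SUP j\<in>J. c * f j) = c * (SUP j\<in>J. f j)"
proof (rule antisym)
  show "(SUP j\<in>J. c * f j) \<le> c * (SUP j\<in>J. f j)"
    using assms by (intro cSUP_least) (auto intro: cSUP_upper)
  have bdd: "bdd_above ((\<lambda>j. c * f j) ` J)"
    using assms by (auto simp: bdd_above_def)
      (metis mult_le_cancel_left_pos)
  have "f j \<le> (SUP j\<in>J. c * f j) / c" if "j \<in> J" for j
    using assms cSUP_upper[OF that bdd] by (simp add: field_simps)
  then have "(SUP j\<in>J. f j) \<le> (SUP j\<in>J. c * f j) / c"
    using assms by (intro cSUP_least)
  then show "c * (SUP j\<in>J. f j) \<le> (SUP j\<in>J. c * f j)"
    using assms by (simp add: field_simps)
qed

lemma bit_seqs_component: "j \<ge> 1 \<Longrightarrow> (\<lambda>x. x j) \<in> borel_measurable bit_seqs"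
  unfolding bit_seqs_def
  by (rule measurable_PiM_component_rev) auto

lemma bit_seqs_range: "x \<in> space bit_seqs \<Longrightarrow> j \<ge> 1 \<Longrightarrow> x j \<in> {0, 1}"
  by (auto simp: bit_seqs_def space_PiM)

lemma majority_bit_range: "majority_bit n y j \<in> {0, 1}"
  by (simp add: majority_bit_def)

text \<open>Flipping a mean is taking the mean of flipped bits, so the flipped means are the
  empirical means of a class of functions. With n \<ge> 1 the constant term survives the
  division.\<close>

lemma flipped_mean_eq:
  assumes "n \<ge> 1"
  shows "flipped_mean n x y j =
    (\<Sum>i=1..n. (1 - majority_bit n y j) * x i j + majority_bit n y j * (1 - x i j)) / real n"
  using assms
  by (simp add: flipped_mean_def emp_mean_def sum.distrib sum_subtractf sum_distrib_left[symmetric]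
      add_divide_distrib diff_divide_distrib right_diff_distrib)

text \<open>The value at j depends only on the flip bit and on a column of n bits, which leaves
  finitely many possibilities. Convergence is not assumed, so ranks stay measurable on the whole
  sample space.\<close>

lemma flipped_mean_finite_range:
  assumes x: "\<And>i j. i \<in> {1..n} \<Longrightarrow> j \<ge> 1 \<Longrightarrow> x i j \<in> {0, 1}"
  shows "finite (flipped_mean n x y ` {1..})"
proof -
  let ?T = "(\<lambda>(a, f). (1 - a) * ((\<Sum>i=1..n. f i) / real n) + a * (1 - (\<Sum>i=1..n. f i) / real n))
     ` ({0, 1} \<times> ({1..n} \<rightarrow>\<^sub>E {0, 1 :: real}))"
  have "finite ?T" by (intro finite_imageI finite_cartesian_product finite_PiE) auto
  moreover have "flipped_mean n x y ` {1..} \<subseteq> ?T"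
  proof safe
    fix j :: nat assume "1 \<le> j"
    then have "(\<lambda>i\<in>{1..n}. x i j) \<in> {1..n} \<rightarrow>\<^sub>E {0, 1}" using x by auto
    then show "flipped_mean n x y j \<in> ?T"
      using majority_bit_range[of n y j]
      by (intro image_eqI[of _ _ "(majority_bit n y j, \<lambda>i\<in>{1..n}. x i j)"])
        (simp_all add: flipped_mean_def emp_mean_def)
  qed
  ultimately show ?thesis by (rule finite_subset[rotated])
qed

lemma flipped_mean_measurable:
  assumes "\<And>i. i \<in> {1..n} \<Longrightarrow> (\<lambda>\<omega>. x \<omega> i j) \<in> borel_measurable M"
    and "\<And>i. i \<in> {1..n} \<Longrightarrow> (\<lambda>\<omega>. y \<omega> i j) \<in> borel_measurable M"
  shows "(\<lambda>\<omega>. flipped_mean n (x \<omega>) (y \<omega>) j) \<in> borel_measurable M"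
proof -
  have [measurable]: "(\<lambda>\<omega>. \<Sum>i=1..n. x \<omega> i j) \<in> borel_measurable M"
    "(\<lambda>\<omega>. \<Sum>i=1..n. y \<omega> i j) \<in> borel_measurable M"
    using assms by (auto intro: borel_measurable_sum)
  show ?thesis
    unfolding flipped_mean_def majority_bit_def emp_mean_def by measurable
qed

text \<open>The claimed inequality as a predicate of two plain arrays, so that it can be cut at a
  fixed second sample and also pulled back along random variables.\<close>

definition good_event :: "nat \<Rightarrow> real \<Rightarrow> (nat \<Rightarrow> real) measure \<Rightarrow>
    (nat \<Rightarrow> nat \<Rightarrow> real) \<Rightarrow> (nat \<Rightarrow> nat \<Rightarrow> real) \<Rightarrow> bool" where
  "good_event n \<delta> \<mu> x y \<longleftrightarrow>
     ereal (Delta n \<mu>) \<le> ereal (16 / sqrt (real n)) *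
         ereal_sqrt (S_opt (decr_rearrangement (flipped_mean n x y)))
       + ereal (sqrt (8 * ln (1 / \<delta>) / real n))"

section \<open>The event under product sampling\<close>

locale bit_sampling = prob_space \<mu> for \<mu> :: "(nat \<Rightarrow> real) measure" +
  fixes n :: nat and \<delta> :: real
  assumes sets_mu: "sets \<mu> = sets bit_seqs" and n: "n \<ge> 1" and \<delta>: "0 < \<delta>" "\<delta> < 1"
begin

abbreviation "Q \<equiv> PiM {1..n} (\<lambda>_. \<mu>)"

lemma space_mu: "space \<mu> = space bit_seqs"
  using sets_mu by (rule sets_eq_imp_space_eq)

lemma prob_space_Q: "prob_space Q"
  by (intro prob_space_PiM) unfold_locales

lemma Q_range:
  assumes "x \<in> space Q" "i \<in> {1..n}" "j \<ge> 1"
  shows "x i j \<in> {0, 1}"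
proof -
  have "x i \<in> space bit_seqs"
    using assms(1) PiE_mem[OF _ assms(2)] unfolding space_PiM space_mu by blast
  then show ?thesis
    using assms(3) by (rule bit_seqs_range)
qed

lemma component_measurable: "j \<ge> 1 \<Longrightarrow> (\<lambda>x. x j) \<in> borel_measurable \<mu>"
  by (simp add: bit_seqs_component measurable_cong_sets[OF sets_mu refl])

lemma Q_component:
  assumes "i \<in> {1..n}" "j \<ge> 1"
  shows "(\<lambda>x. x i j) \<in> borel_measurable Q"
  using measurable_component_singleton[of i "{1..n}" "\<lambda>_. \<mu>", OF assms(1)]
    component_measurable[OF assms(2)]
  by (rule measurable_compose)

lemma good_event_measurable: "{(x, y) \<in> space (Q \<Otimes>\<^sub>M Q). good_event n \<delta> \<mu> x y} \<in> sets (Q \<Otimes>\<^sub>M Q)"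
proof -
  let ?u = "\<lambda>p. flipped_mean n (fst p) (snd p)"
  have [measurable]: "(\<lambda>p. S_opt (decr_rearrangement (?u p))) \<in> borel_measurable (Q \<Otimes>\<^sub>M Q)"
  proof (rule S_opt_decr_rearrangement_measurable)
    show "finite (?u p ` {1..})" if "p \<in> space (Q \<Otimes>\<^sub>M Q)" for p
      using that by (intro flipped_mean_finite_range Q_range) (auto simp: space_pair_measure)
    show "(\<lambda>p. ?u p j) \<in> borel_measurable (Q \<Otimes>\<^sub>M Q)" if "j \<ge> 1" for j
      using that by (intro flipped_mean_measurable measurable_compose[OF measurable_fst]
          measurable_compose[OF measurable_snd] Q_component)
  qed
  have "{p \<in> space (Q \<Otimes>\<^sub>M Q). good_event n \<delta> \<mu> (fst p) (snd p)} \<in> sets (Q \<Otimes>\<^sub>M Q)"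
    unfolding good_event_def by measurable
  then show ?thesis by (simp add: case_prod_beta')
qed

lemma Delta_eq_deviation:
  assumes a: "\<And>j. j \<ge> 1 \<Longrightarrow> a j \<in> {0, 1 :: real}"
    and g: "g = (\<lambda>j x. (1 - a j) * x j + a j * (1 - x j))"
  shows "bounded_class \<mu> {1..} g"
    and "real n * Delta n \<mu> = (\<integral>x. bounded_class.deviation \<mu> {1..} g {1..n} x \<partial>Q)"
proof -
  have mg: "g j \<in> borel_measurable \<mu>" if "j \<ge> 1" for j
    unfolding g using component_measurable[OF that] by measurable
  have rg: "g j x \<in> {0..1}" if "j \<ge> 1" "x \<in> space \<mu>" for j x
    using a[OF that(1)] bit_seqs_range[of x j] that by (auto simp: g space_mu)
  show bc: "bounded_class \<mu> {1..} g"
    by unfold_locales (use mg rg in auto)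
  interpret bounded_class \<mu> "{1..}" g by (rule bc)
  have dev: "deviation {1..n} x = real n * (SUP j\<in>{1..}. \<bar>emp_mean n x j - mean_seq \<mu> j\<bar>)"
    if x: "x \<in> space Q" for x
  proof -
    have "\<bar>emp_mean n x j - mean_seq \<mu> j\<bar> \<le> 1" if j: "j \<ge> 1" for j
    proof -
      have "(\<Sum>i=1..n. x i j) \<le> (\<Sum>i=1..n. 1)" "(\<Sum>i=1..n. x i j) \<ge> 0"
        using Q_range[OF x _ j] by (force intro!: sum_mono sum_nonneg)+
      then have "emp_mean n x j \<in> {0..1}" using n by (simp add: emp_mean_def)
      moreover have "mean_seq \<mu> j \<le> (\<integral>x. 1 \<partial>\<mu>)"
        unfolding mean_seq_def using component_measurable[OF j] bit_seqs_range[OF _ j]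
        by (intro integral_mono integrable_const_bound[of _ 1]) (force simp: space_mu)+
      moreover have "mean_seq \<mu> j \<ge> 0"
        unfolding mean_seq_def using bit_seqs_range[OF _ j]
        by (intro integral_nonneg_AE AE_I2) (force simp: space_mu)
      ultimately show ?thesis by (auto simp: prob_space)
    qed
    then have bdd: "bdd_above ((\<lambda>j. \<bar>emp_mean n x j - mean_seq \<mu> j\<bar>) ` {1..})"
      by (intro SUP_abs_bounded(1)[of _ _ 1]) auto
    have "\<bar>\<Sum>i=1..n. g j (x i) - (\<integral>y. g j y \<partial>\<mu>)\<bar> = real n * \<bar>emp_mean n x j - mean_seq \<mu> j\<bar>"
      if j: "j \<ge> 1" for j
    proof -
      have int: "integrable \<mu> (\<lambda>x. x j)"
        using component_measurable[OF j] bit_seqs_range[OF _ j]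
        by (intro integrable_const_bound[of _ 1]) (force simp: space_mu)+
      have E: "(\<integral>y. g j y \<partial>\<mu>) = (1 - a j) * mean_seq \<mu> j + a j * (1 - mean_seq \<mu> j)"
        unfolding g mean_seq_def using int by (simp add: prob_space)
      \<comment> \<open>Flipping multiplies every centred term by 1 - 2 a j, which is 1 or -1 and
        disappears under the absolute value.\<close>
      have "(\<Sum>i=1..n. g j (x i) - (\<integral>y. g j y \<partial>\<mu>))
          = (\<Sum>i=1..n. (1 - 2 * a j) * (x i j - mean_seq \<mu> j))"
        unfolding E by (intro sum.cong refl) (simp add: g algebra_simps)
      also have "\<dots> = (1 - 2 * a j) * (real n * (emp_mean n x j - mean_seq \<mu> j))"
        using n by (simp add: sum_distrib_left[symmetric] sum_subtractf emp_mean_def right_diff_distrib)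
      finally show ?thesis
        using a[OF j] by (auto simp: abs_mult)
    qed
    then have "deviation {1..n} x = (SUP j\<in>{1..}. real n * \<bar>emp_mean n x j - mean_seq \<mu> j\<bar>)"
      unfolding deviation_def by (intro SUP_cong) auto
    also have "\<dots> = real n * (SUP j\<in>{1..}. \<bar>emp_mean n x j - mean_seq \<mu> j\<bar>)"
      using n bdd by (intro SUP_mult_left_real) auto
    finally show ?thesis .
  qed
  have "(\<integral>x. deviation {1..n} x \<partial>Q)
      = (\<integral>x. real n * (SUP j\<in>{1..}. \<bar>emp_mean n x j - mean_seq \<mu> j\<bar>) \<partial>Q)"
    by (intro Bochner_Integration.integral_cong refl dev)
  then show "real n * Delta n \<mu> = (\<integral>x. deviation {1..n} x \<partial>Q)"
    by (simp add: Delta_def)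
qed

text \<open>For fixed y the flip bits are constants, so g is a deterministic class. On the event of
  the concentration bound the inequality follows without further randomness.\<close>

lemma good_event_section:
  "measure Q {x \<in> space Q. good_event n \<delta> \<mu> x y} \<ge> 1 - \<delta>" if y: "y \<in> space Q"
proof -
  interpret Q: prob_space Q by (rule prob_space_Q)
  define a where "a = majority_bit n y"
  define g where "g = (\<lambda>j (x :: nat \<Rightarrow> real). (1 - a j) * x j + a j * (1 - x j))"
  have a: "a j \<in> {0, 1}" for j
    unfolding a_def by (rule majority_bit_range)
  interpret bounded_class \<mu> "{1..}" g
    using Delta_eq_deviation(1)[OF a g_def] .
  let ?d = "sqrt (8 * ln (1 / \<delta>) / real n)"
  let ?A = "{x \<in> space Q. (\<integral>x. deviation {1..n} x \<partial>Q)
      \<le> 2 * emp_rademacher {1..n} x + sqrt (8 * real n * ln (1 / \<delta>))}"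
  have d: "sqrt (8 * real n * ln (1 / \<delta>)) = real n * ?d"
  proof -
    have "8 * real n * ln (1 / \<delta>) = (real n)\<^sup>2 * (8 * ln (1 / \<delta>) / real n)"
      using n by (simp add: power2_eq_square)
    then show ?thesis by (simp only: real_sqrt_mult real_sqrt_abs abs_of_nat)
  qed
  have "good_event n \<delta> \<mu> x y" if "x \<in> ?A" for x
  proof (cases "S_opt (decr_rearrangement (flipped_mean n x y)) = \<infinity>")
    \<comment> \<open>The right side is \<infinity> because n \<ge> 1 keeps the factor in front of
      it positive.\<close>
    case True
    then show ?thesis using n by (simp add: good_event_def ereal_sqrt_def)
  next
    case False
    have x: "x \<in> space Q" using that by simp
    have "g j (x i) \<in> {0, 1}" if "i \<in> {1..n}" "j \<ge> 1" for i j
      using a[of j] Q_range[OF x that] by (auto simp: g_def)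
    moreover have "flipped_mean n x y j = (\<Sum>i=1..n. g j (x i)) / real n" for j
      unfolding flipped_mean_eq[OF n] g_def a_def ..
    ultimately obtain V where V: "V \<ge> 0" "S_opt (decr_rearrangement (flipped_mean n x y)) = ereal V"
      "emp_rademacher {1..n} x \<le> 4 * sqrt (real n * V)"
      using rademacher_avg_le_S[OF n _ _ False, of "\<lambda>i j. g j (x i)"] by blast
    have "real n * Delta n \<mu> \<le> 2 * emp_rademacher {1..n} x + real n * ?d"
      using that Delta_eq_deviation(2)[OF a g_def] d by simp
    also have "\<dots> \<le> 8 * sqrt (real n * V) + real n * ?d"
      using V by simp
    also have "sqrt (real n * V) = real n * (sqrt V / sqrt (real n))"
      using n by (simp add: real_sqrt_mult real_div_sqrt field_simps)
    also have "8 * (real n * (sqrt V / sqrt (real n))) + real n * ?d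
        = real n * (8 * sqrt V / sqrt (real n) + ?d)"
      by (simp add: distrib_left)
    finally have "Delta n \<mu> \<le> 8 * sqrt V / sqrt (real n) + ?d"
      using n by simp
    \<comment> \<open>The 8 is 2 from symmetrization times 4 from the maximal inequality.\<close>
    also have "\<dots> \<le> 16 / sqrt (real n) * sqrt V + ?d"
      using V by (simp add: divide_right_mono)
    finally show ?thesis
      using V by (simp add: good_event_def ereal_sqrt_def)
  qed
  then have sub: "?A \<subseteq> {x \<in> space Q. good_event n \<delta> \<mu> x y}" by auto
  have "{x \<in> space Q. good_event n \<delta> \<mu> x y} \<in> sets Q"
  proof -
    have "(\<lambda>x. (x, y)) -` {(x, y) \<in> space (Q \<Otimes>\<^sub>M Q). good_event n \<delta> \<mu> x y} \<in> sets Q"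
      by (rule sets_Pair2[OF good_event_measurable])
    also have "(\<lambda>x. (x, y)) -` {(x, y) \<in> space (Q \<Otimes>\<^sub>M Q). good_event n \<delta> \<mu> x y}
        = {x \<in> space Q. good_event n \<delta> \<mu> x y}"
      using y by (auto simp: space_pair_measure)
    finally show ?thesis .
  qed
  from Q.finite_measure_mono[OF sub this] deviation_le_emp_rademacher[OF n \<delta>]
  show ?thesis by linarith
qed

text \<open>Fubini over the second sample: every section has probability at least 1 - \<delta>,
  uniformly in y.\<close>

lemma good_event_prob:
  "measure (Q \<Otimes>\<^sub>M Q) {(x, y) \<in> space (Q \<Otimes>\<^sub>M Q). good_event n \<delta> \<mu> x y} \<ge> 1 - \<delta>"
proof -
  interpret Q: prob_space Q by (rule prob_space_Q)
  interpret QQ: pair_prob_space Q Q ..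
  let ?E = "{(x, y) \<in> space (Q \<Otimes>\<^sub>M Q). good_event n \<delta> \<mu> x y}"
  have "ennreal (1 - \<delta>) = (\<integral>\<^sup>+y. ennreal (1 - \<delta>) \<partial>Q)"
    by (simp only: nn_integral_const Q.emeasure_space_1 mult_1_right)
  also have "\<dots> \<le> (\<integral>\<^sup>+y. emeasure Q ((\<lambda>x. (x, y)) -` ?E) \<partial>Q)"
  proof (rule nn_integral_mono)
    fix y assume y: "y \<in> space Q"
    have eq: "(\<lambda>x. (x, y)) -` ?E = {x \<in> space Q. good_event n \<delta> \<mu> x y}"
      using y by (auto simp: space_pair_measure)
    show "ennreal (1 - \<delta>) \<le> emeasure Q ((\<lambda>x. (x, y)) -` ?E)"
      unfolding eq Q.emeasure_eq_measure by (intro ennreal_leI good_event_section y)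
  qed
  also have "\<dots> = emeasure (Q \<Otimes>\<^sub>M Q) ?E"
    by (rule QQ.emeasure_pair_measure_alt2[OF good_event_measurable, symmetric])
  finally show ?thesis
    by (simp only: QQ.emeasure_eq_measure ennreal_le_iff[OF measure_nonneg])
qed

end

section \<open>Transfer from the product space to the given random variables\<close>

theorem theorem5:
  fixes \<mu> :: "(nat \<Rightarrow> real) measure" and n :: nat and \<delta> :: real
    and M :: "'w measure" and X X' :: "nat \<Rightarrow> 'w \<Rightarrow> nat \<Rightarrow> real"
  assumes "prob_space \<mu>" and "sets \<mu> = sets bit_seqs"
    and "n \<ge> 1" and "0 < \<delta>" and "\<delta> < 1"
    and "prob_space M"
    and "\<And>i. i \<in> {1..n} \<Longrightarrow> X i \<in> measurable M bit_seqs"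
    and "\<And>i. i \<in> {1..n} \<Longrightarrow> distr M bit_seqs (X i) = \<mu>"
    and "prob_space.indep_vars M (\<lambda>_. bit_seqs) X {1..n}"
    and "\<And>i. i \<in> {1..n} \<Longrightarrow> X' i \<in> measurable M bit_seqs"
    and "\<And>i. i \<in> {1..n} \<Longrightarrow> distr M bit_seqs (X' i) = \<mu>"
    and "prob_space.indep_vars M (\<lambda>_. bit_seqs) X' {1..n}"
    and "prob_space.indep_var M
           (PiM {1..n} (\<lambda>_. bit_seqs)) (\<lambda>\<omega>. \<lambda>i\<in>{1..n}. X i \<omega>)
           (PiM {1..n} (\<lambda>_. bit_seqs)) (\<lambda>\<omega>. \<lambda>i\<in>{1..n}. X' i \<omega>)"
  shows "measure M {\<omega> \<in> space M.
           ereal (Delta n \<mu>) \<le>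
             ereal (16 / sqrt (real n)) *
               ereal_sqrt (S_opt (decr_rearrangement
                 (flipped_mean n (\<lambda>i. X i \<omega>) (\<lambda>i. X' i \<omega>))))
             + ereal (sqrt (8 * ln (1 / \<delta>) / real n))}
         \<ge> 1 - \<delta>"
proof -
  interpret M: prob_space M by fact
  interpret prob_space \<mu> by fact
  interpret bit_sampling \<mu> n \<delta> by unfold_locales fact+
  let ?B = "PiM {1..n} (\<lambda>_. bit_seqs)"
  let ?x = "\<lambda>\<omega>. \<lambda>i\<in>{1..n}. X i \<omega>" and ?y = "\<lambda>\<omega>. \<lambda>i\<in>{1..n}. X' i \<omega>"
  let ?E = "{(x, y) \<in> space (Q \<Otimes>\<^sub>M Q). good_event n \<delta> \<mu> x y}"
  have distr: "distr M ?B (\<lambda>\<omega>. \<lambda>i\<in>{1..n}. Z i \<omega>) = Q"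
    if "\<And>i. i \<in> {1..n} \<Longrightarrow> Z i \<in> measurable M bit_seqs"
      and Z: "\<And>i. i \<in> {1..n} \<Longrightarrow> distr M bit_seqs (Z i) = \<mu>"
      and "M.indep_vars (\<lambda>_. bit_seqs) Z {1..n}" for Z
  proof -
    have "distr M ?B (\<lambda>\<omega>. \<lambda>i\<in>{1..n}. Z i \<omega>) = PiM {1..n} (\<lambda>i. distr M bit_seqs (Z i))"
      using that assms(3) M.indep_vars_iff_distr_eq_PiM'[where I = "{1..n}" and X = Z and M' = "\<lambda>_. bit_seqs"] by auto
    also have "\<dots> = Q" by (intro PiM_cong refl Z)
    finally show ?thesis .
  qed
  have x: "distr M ?B ?x = Q"
    by (intro distr assms)
  have y: "distr M ?B ?y = Q"
    by (intro distr assms)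
  \<comment> \<open>Independence of the two blocks, each with law \<open>Q\<close>, is equivalent to
    their joint law being the product; this moves the event to \<open>M\<close>.\<close>
  have xy: "distr M (?B \<Otimes>\<^sub>M ?B) (\<lambda>\<omega>. (?x \<omega>, ?y \<omega>)) = Q \<Otimes>\<^sub>M Q"
    and rv: "?x \<in> measurable M ?B" "?y \<in> measurable M ?B"
    using assms(13) x y unfolding M.indep_var_distribution_eq by auto
  have sets_B: "sets (Q \<Otimes>\<^sub>M Q) = sets (?B \<Otimes>\<^sub>M ?B)"
    by (intro sets_pair_measure_cong sets_PiM_cong refl sets_mu)
  have E: "?E \<in> sets (?B \<Otimes>\<^sub>M ?B)"
    using good_event_measurable sets_B by simp
  \<comment> \<open>The blocks are restricted to \<open>{1..n}\<close> to be elements of the product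
    space; sums over \<open>1..n\<close> do not notice the restriction.\<close>
  have preimage: "(\<lambda>\<omega>. (?x \<omega>, ?y \<omega>)) -` ?E \<inter> space M
      = {\<omega> \<in> space M. good_event n \<delta> \<mu> (\<lambda>i. X i \<omega>) (\<lambda>i. X' i \<omega>)}"
  proof -
    have "flipped_mean n (?x \<omega>) (?y \<omega>) = flipped_mean n (\<lambda>i. X i \<omega>) (\<lambda>i. X' i \<omega>)" for \<omega>
      by (simp add: fun_eq_iff flipped_mean_def majority_bit_def emp_mean_def)
    then have "good_event n \<delta> \<mu> (?x \<omega>) (?y \<omega>) = good_event n \<delta> \<mu> (\<lambda>i. X i \<omega>) (\<lambda>i. X' i \<omega>)" for \<omega>
      by (simp add: good_event_def)
    moreover have "(?x \<omega>, ?y \<omega>) \<in> space (Q \<Otimes>\<^sub>M Q)" if "\<omega> \<in> space M" for \<omega>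
      using that measurable_space[OF rv(1)] measurable_space[OF rv(2)]
      unfolding sets_eq_imp_space_eq[OF sets_B] by (auto simp: space_pair_measure)
    ultimately show ?thesis by auto
  qed
  have "1 - \<delta> \<le> measure (Q \<Otimes>\<^sub>M Q) ?E"
    by (rule good_event_prob)
  also have "\<dots> = measure (distr M (?B \<Otimes>\<^sub>M ?B) (\<lambda>\<omega>. (?x \<omega>, ?y \<omega>))) ?E"
    by (simp only: xy)
  also have "\<dots> = measure M ((\<lambda>\<omega>. (?x \<omega>, ?y \<omega>)) -` ?E \<inter> space M)"
    by (rule measure_distr[OF measurable_Pair[OF rv] E])
  finally show ?thesis
    unfolding preimage unfolding good_event_def .
qed

end
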